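(* If $(f,g)\in\mathcal{C}$, then the (unique) minimal set of the semigroup $\langle f,g\rangle_{+}$ acting on $I=[0,1]$ is homeomorphic to the Cantor set.
   Context: Let $I=[0,1]$ and let $\mathrm{Diff}^1_{\mathrm{im}}(I)$ be the set of $C^1$ maps $I\to I$ that are $C^1$-diffeomorphisms onto their images. The set $\mathcal{A}\subset(\mathrm{Diff}^1_{\mathrm{im}}(I))^2$ consists of the pairs $(f,g)$ with: $f(0)=0$ and $g(1)=1$; $f(x)<x<g(x)$ for all $x\in(0,1)$; $0<g(0)<f(1)<1$. $\langle f,g\rangle_{+}$ is the semigroup generated by $f$ and $g$ under composition. For $x\in I$, $\mathcal{O}_{+}(x)=\{\phi(x)\mid\phi\in\langle f,g\rangle_{+}\}$. A non-empty set $K\subset I$ is a minimal set if $\overline{\mathcal{O}_{+}(x)}=K$ for every $x\in K$. It is known that for $(f,g)\in\mathcal{A}$ there is a unique minimal set $K$, and $K=\overline{\mathcal{O}_{+}(0)}=\overline{\mathcal{O}_{+}(1)}$. For $(f,g)\in\mathcal{A}$ put $W=[g(0),f(1)]=f(I)\cap g(I)$, $F_n=[f^{n+1}(1),f^n(1)]$, $G_n=[g^n(0),g^{n+1}(0)]$ (powers denote iterates). $\mathrm{int}(X)$ denotes the interior of $X$. Property $\mathsf{So}$ (single overlapping): $W$ is contained in the interior of $F_1\cup G_1$; equivalently $f^2(1)<g(0)$ and $f(1)<g^2(0)$. Property $\mathsf{Ho}$ (hole; for pairs satisfying $\mathsf{So}$): there are closed intervals $H_f\subset\mathrm{int}(F_1\setminus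 W)$ and $H_g\subset\mathrm{int}(G_1\setminus W)$ with non-empty interior such that $g(H_f)=H_g$ and $f(H_g)=H_f$. Induced maps: $\mathcal{F}:F_1\setminus\{f(1)\}\to G_1$ is $\mathcal{F}(x)=g^{-n(x)}(f^{-1}(x))$, where $n(x)$ is the least non-negative integer with $g^{-n(x)}(f^{-1}(x))\in G_1$. Similarly $\mathcal{G}:G_1\setminus\{g(0)\}\to F_1$ is $\mathcal{G}(x)=f^{-m(x)}(g^{-1}(x))$, where $m(x)$ is the least non-negative integer with $f^{-m(x)}(g^{-1}(x))\in F_1$. Both are piecewise $C^1$. Property $\mathsf{Ee}$ (eventual expansion): there is $\mu>1$ such that $\mathcal{F}'(y)>\mu$ for every $y\in F_1\setminus H_f$ at which $\mathcal{F}'(y)$ makes sense, and $\mathcal{G}'(y)>\mu$ for every $y\in G_1\setminus H_g$ at which $\mathcal{G}'(y)$ makes sense. Property $\mathsf{Ca}$ (castration): with $R_f=\mathcal{F}^{-1}(H_g)\subset F_1$ and $R_g=\mathcal{G}^{-1}(H_f)\subset G_1$, one has $W\subset\mathrm{int}(R_f)\cup\mathrm{int}(R_g)$. $\mathcal{C}$ is the set of pairs $(f,g)\in\mathcal{A}$ satisfying $\mathsf{So}$, $\mathsf{Ho}$, $\mathsf{Ee}$ and $\mathsf{Ca}$ (the last two with respect to the intervals $H_f,H_g$ of $\mathsf{Ho}$). *)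

theory Defs
  imports "HOL-Analysis.Analysis"
begin

abbreviation unit_I :: "real set" where
  "unit_I \<equiv> {0..1}"

text \<open>
  A map from I to I is represented by a function on the reals; only its values on I matter.
  Accordingly derivatives are taken within the domain (one-sided at its end points).
\<close>

definition C1_within :: "real set \<Rightarrow> (real \<Rightarrow> real) \<Rightarrow> bool" where
  "C1_within S f \<longleftrightarrow>
     (\<exists>f'. (\<forall>x\<in>S. (f has_real_derivative f' x) (at x within S)) \<and> continuous_on S f')"

abbreviation I_inv :: "(real \<Rightarrow> real) \<Rightarrow> real \<Rightarrow> real" where
  "I_inv f \<equiv> the_inv_into unit_I f"

definition Diff1_im :: "(real \<Rightarrow> real) set" where
  "Diff1_im = {f. f ` unit_I \<subseteq> unit_I \<and> inj_on f unit_I \<and>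
                  C1_within unit_I f \<and> C1_within (f ` unit_I) (I_inv f)}"

definition class_A :: "((real \<Rightarrow> real) \<times> (real \<Rightarrow> real)) set" where
  "class_A = {(f, g). f \<in> Diff1_im \<and> g \<in> Diff1_im \<and>
                f 0 = 0 \<and> g 1 = 1 \<and>
                (\<forall>x. 0 < x \<and> x < 1 \<longrightarrow> f x < x \<and> x < g x) \<and>
                0 < g 0 \<and> g 0 < f 1 \<and> f 1 < 1}"

text \<open>The generated semigroup consists of non-empty words; the identity is not added.\<close>

inductive_set gen_semigroup :: "(real \<Rightarrow> real) \<Rightarrow> (real \<Rightarrow> real) \<Rightarrow> (real \<Rightarrow> real) set"
  for f g where
  gen_left: "f \<in> gen_semigroup f g"
| gen_right: "g \<in> gen_semigroup f g"
| gen_comp: "\<phi> \<in> gen_semigroup f g \<Longrightarrow> \<psi> \<in> gen_semigroup f g \<Longrightarrow> \<phi> \<circ> \<psi> \<in> gen_semigroup f g"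

definition orbit_plus :: "(real \<Rightarrow> real) \<Rightarrow> (real \<Rightarrow> real) \<Rightarrow> real \<Rightarrow> real set" where
  "orbit_plus f g x = {\<phi> x | \<phi>. \<phi> \<in> gen_semigroup f g}"

definition minimal_set :: "(real \<Rightarrow> real) \<Rightarrow> (real \<Rightarrow> real) \<Rightarrow> real set \<Rightarrow> bool" where
  "minimal_set f g K \<longleftrightarrow>
     K \<noteq> {} \<and> K \<subseteq> unit_I \<and> (\<forall>x\<in>K. closure (orbit_plus f g x) = K)"

definition overlap_W :: "(real \<Rightarrow> real) \<Rightarrow> (real \<Rightarrow> real) \<Rightarrow> real set" where
  "overlap_W f g = {g 0..f 1}"

definition fund_F :: "(real \<Rightarrow> real) \<Rightarrow> nat \<Rightarrow> real set" where
  "fund_F f n = {(f ^^ (n + 1)) 1..(f ^^ n) 1}"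

definition fund_G :: "(real \<Rightarrow> real) \<Rightarrow> nat \<Rightarrow> real set" where
  "fund_G g n = {(g ^^ n) 0..(g ^^ (n + 1)) 0}"

definition prop_So :: "(real \<Rightarrow> real) \<Rightarrow> (real \<Rightarrow> real) \<Rightarrow> bool" where
  "prop_So f g \<longleftrightarrow> overlap_W f g \<subseteq> interior (fund_F f 1 \<union> fund_G g 1)"

definition nondeg_closed_interval :: "real set \<Rightarrow> bool" where
  "nondeg_closed_interval H \<longleftrightarrow> (\<exists>a b. a < b \<and> H = {a..b})"

definition prop_Ho ::
  "(real \<Rightarrow> real) \<Rightarrow> (real \<Rightarrow> real) \<Rightarrow> real set \<Rightarrow> real set \<Rightarrow> bool" where
  "prop_Ho f g Hf Hg \<longleftrightarrow>
     nondeg_closed_interval Hf \<and> nondeg_closed_interval Hg \<and>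
     Hf \<subseteq> interior (fund_F f 1 - overlap_W f g) \<and>
     Hg \<subseteq> interior (fund_G g 1 - overlap_W f g) \<and>
     g ` Hf = Hg \<and> f ` Hg = Hf"

text \<open>
  The induced maps are meaningful on \<open>dom_F\<close> and \<open>dom_G\<close> only. There, for pairs in
  \<open>class_A\<close> with \<open>prop_So\<close>, the least number exists and every inverse up to that number of
  iterations is applied to a point of the corresponding image of I, so the unspecified values
  of \<open>the_inv_into\<close> play no role.
\<close>

definition dom_F :: "(real \<Rightarrow> real) \<Rightarrow> real set" where
  "dom_F f = fund_F f 1 - {f 1}"

definition dom_G :: "(real \<Rightarrow> real) \<Rightarrow> real set" where
  "dom_G g = fund_G g 1 - {g 0}"

definition induced_F :: "(real \<Rightarrow> real) \<Rightarrow> (real \<Rightarrow> real) \<Rightarrow> real \<Rightarrow> real" where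
  "induced_F f g x =
     (I_inv g ^^ (LEAST n. (I_inv g ^^ n) (I_inv f x) \<in> fund_G g 1)) (I_inv f x)"

definition induced_G :: "(real \<Rightarrow> real) \<Rightarrow> (real \<Rightarrow> real) \<Rightarrow> real \<Rightarrow> real" where
  "induced_G f g x =
     (I_inv f ^^ (LEAST m. (I_inv f ^^ m) (I_inv g x) \<in> fund_F f 1)) (I_inv g x)"

text \<open>
  The derivative of an induced map makes sense at a point of its domain if the map is
  differentiable there relative to the domain (one-sided at an end point of the domain).
\<close>

definition prop_Ee ::
  "(real \<Rightarrow> real) \<Rightarrow> (real \<Rightarrow> real) \<Rightarrow> real set \<Rightarrow> real set \<Rightarrow> bool" where
  "prop_Ee f g Hf Hg \<longleftrightarrow>
     (\<exists>\<mu>>1.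
        (\<forall>y\<in>dom_F f - Hf. \<forall>D.
           (induced_F f g has_real_derivative D) (at y within dom_F f) \<longrightarrow> \<mu> < D) \<and>
        (\<forall>y\<in>dom_G g - Hg. \<forall>D.
           (induced_G f g has_real_derivative D) (at y within dom_G g) \<longrightarrow> \<mu> < D))"

definition prop_Ca ::
  "(real \<Rightarrow> real) \<Rightarrow> (real \<Rightarrow> real) \<Rightarrow> real set \<Rightarrow> real set \<Rightarrow> bool" where
  "prop_Ca f g Hf Hg \<longleftrightarrow>
     overlap_W f g \<subseteq>
       interior {x \<in> dom_F f. induced_F f g x \<in> Hg} \<union>
       interior {x \<in> dom_G g. induced_G f g x \<in> Hf}"

definition class_C :: "((real \<Rightarrow> real) \<times> (real \<Rightarrow> real)) set" where
  "class_C = {(f, g). (f, g) \<in> class_A \<and> prop_So f g \<and>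
                (\<exists>Hf Hg. prop_Ho f g Hf Hg \<and> prop_Ee f g Hf Hg \<and> prop_Ca f g Hf Hg)}"

text \<open>The middle-thirds Cantor set.\<close>

primrec cantor_stage :: "nat \<Rightarrow> real set" where
  "cantor_stage 0 = {0..1}"
| "cantor_stage (Suc n) =
     (\<lambda>x. x / 3) ` cantor_stage n \<union> (\<lambda>x. 2 / 3 + x / 3) ` cantor_stage n"

definition cantor_set :: "real set" where
  "cantor_set = (\<Inter>n. cantor_stage n)"

end

theory Submission
  imports Defs
begin

text \<open>
  Every forward orbit accumulates at \<open>0\<close>, because the iterates of \<open>f\<close> converge to \<open>0\<close>; as \<open>0\<close> is
  fixed by \<open>f\<close>, this forces \<open>K = closure (orbit_plus f g 0)\<close> to be the only minimal set. It is
  perfect, since \<open>\<phi> 0\<close> is the limit of the points \<open>\<phi> (f\<^sup>n (g 0))\<close>, which differ from it by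
  injectivity (\<open>attractor_limpt\<close>). A non-empty compact perfect subset of the line without interior
  is homeomorphic to any other such set (\<open>cantor_like_homeomorphic\<close>), so what has to be shown is
  that \<open>K\<close> contains no interval (\<open>interior_K\<close>).

  The two holes are exchanged by \<open>f\<close> and \<open>g\<close> and cannot be entered from outside, so \<open>K\<close> does not
  meet their interiors. On the other hand \<open>K = f ` K \<union> g ` K\<close>, so outside the overlap
  \<open>W = [g 0, f 1]\<close> exactly one inverse branch applies to a point of \<open>K\<close> and it stays in \<open>K\<close>.
  Castration extends this to \<open>W\<close>: on \<open>interior R\<^sub>f\<close> the branch through \<open>f\<close> ends in the hole \<open>H\<^sub>g\<close>, so
  apart from countably many points, which land on the boundary of the hole, only the branch through
  \<open>g\<close> remains, and conversely. Hence an open interval \<open>J \<subseteq> K\<close> inside the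
  overlap lies entirely in \<open>f ` K\<close> or entirely in \<open>g ` K\<close> (\<open>interval_in_one_image\<close>), and the
  corresponding induced map sends it into \<open>K\<close> again.

  This map has no discontinuity in \<open>J\<close>. Its discontinuities come from the points \<open>g\<^sup>n (g 0)\<close> and
  \<open>f\<^sup>n (f 1)\<close>, and none of them is interior to \<open>K\<close>: the point \<open>g 0\<close> lies in \<open>interior R\<^sub>f\<close>, and to
  the left of \<open>g 0\<close> there is no branch through \<open>g\<close>, so \<open>K\<close> is countable on a one-sided
  neighbourhood (\<open>g_0_notin_interior\<close>); pulling back by \<open>g\<close> gives the other points. Therefore
  eventual expansion applies to \<open>J\<close> as a whole: every interval of \<open>K\<close> in the two fundamental domains
  produces another one that is longer by the factor \<open>\<mu> > 1\<close> (\<open>core_interval_grows\<close>), which is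
  impossible in a bounded set.

  The hypotheses on the induced maps are first rewritten without inverses. On the branch with
  \<open>n(x) = j\<close> the map \<open>\<F>\<close> is the inverse of \<open>f \<circ> g\<^sup>j\<close>, so expansion of \<open>\<F>\<close> is a length estimate for
  \<open>f \<circ> g\<^sup>j\<close> (\<open>induced_expansion\<close>), and \<open>R\<^sub>f\<close> is contained in the union of the sets \<open>f (g\<^sup>j H\<^sub>g)\<close>
  (\<open>induced_preimage\<close>). The result is the locale \<open>holed_pair\<close>, which is invariant under the
  reflection of the interval, so that each one-sided argument is given for one side only.
\<close>

section \<open>Compact perfect sets without interior\<close>

definition cantor_like :: "real set \<Rightarrow> bool" where
  "cantor_like A \<longleftrightarrow> compact A \<and> A \<noteq> {} \<and> (\<forall>x\<in>A. x islimpt A) \<and> interior A = {}"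

text \<open>
  A cut taken in the open middle third, rather than in an arbitrary gap, makes both parts shorter by a
  definite factor.
\<close>

definition cut_point :: "real set \<Rightarrow> real" where
  "cut_point A = (SOME m. Inf A + (Sup A - Inf A) / 3 < m \<and> m < Sup A - (Sup A - Inf A) / 3 \<and> m \<notin> A)"

definition half :: "real set \<Rightarrow> bool \<Rightarrow> real set" where
  "half A r = (if r then A \<inter> {cut_point A<..} else A \<inter> {..<cut_point A})"

text \<open>
  Perfectness survives because a point of the open set \<open>U\<close> is approached by points of \<open>A\<close> inside
  \<open>U\<close>. Closedness of \<open>A \<inter> U\<close> holds in the application because the cut is made outside \<open>A\<close>.
\<close>

lemma cantor_like_Int_open:
  assumes "cantor_like A" "open U" "closed (A \<inter> U)" "A \<inter> U \<noteq> {}"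
  shows "cantor_like (A \<inter> U)"
proof -
  have "compact (A \<inter> U)"
    using assms compact_Int_closed[of A "A \<inter> U"] by (simp add: cantor_like_def Int_left_absorb)
  moreover have "x islimpt A \<inter> U" if "x \<in> A \<inter> U" for x
    using that assms islimpt_Int_eventually[of x A U] eventually_at_topological
    by (metis Int_iff cantor_like_def)
  moreover have "interior (A \<inter> U) = {}"
    using assms(1) by (auto simp: cantor_like_def)
  ultimately show ?thesis using assms(4) by (simp add: cantor_like_def)
qed

lemma cantor_like_Inf_less_Sup:
  assumes "cantor_like A"
  shows "Inf A \<in> A" "Sup A \<in> A" "Inf A < Sup A"
proof -
  have A: "compact A" "A \<noteq> {}" using assms by (auto simp: cantor_like_def)
  then have bd: "bdd_below A" "bdd_above A" "closed A"
    by (auto simp: compact_imp_bounded bounded_imp_bdd_below bounded_imp_bdd_above compact_imp_closed)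
  show I: "Inf A \<in> A" using A bd by (intro closed_contains_Inf)
  show "Sup A \<in> A" using A bd by (intro closed_contains_Sup)
  obtain y where "y \<in> A" "y \<noteq> Inf A"
    using assms I by (metis cantor_like_def islimptE open_UNIV UNIV_I)
  then show "Inf A < Sup A"
    using bd by (metis cInf_lower cSup_upper order_less_le order_less_le_trans)
qed

lemma cut_point:
  assumes "cantor_like A"
  shows "Inf A + (Sup A - Inf A) / 3 < cut_point A"
    and "cut_point A < Sup A - (Sup A - Inf A) / 3"
    and "cut_point A \<notin> A"
proof -
  let ?U = "{Inf A + (Sup A - Inf A) / 3 <..< Sup A - (Sup A - Inf A) / 3}"
  have "?U \<noteq> {}" using cantor_like_Inf_less_Sup(3)[OF assms] by (simp add: field_simps)
  then have "\<not> ?U \<subseteq> A"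
    using assms interior_maximal[of ?U A] by (auto simp: cantor_like_def)
  then have "\<exists>m. Inf A + (Sup A - Inf A) / 3 < m \<and> m < Sup A - (Sup A - Inf A) / 3 \<and> m \<notin> A"
    by auto
  from someI_ex[OF this] show "Inf A + (Sup A - Inf A) / 3 < cut_point A"
    "cut_point A < Sup A - (Sup A - Inf A) / 3" "cut_point A \<notin> A"
    unfolding cut_point_def by auto
qed

lemma cantor_like_half:
  assumes "cantor_like A"
  shows "cantor_like (half A r)"
proof -
  note ends = cantor_like_Inf_less_Sup[OF assms] and cut = cut_point[OF assms]
  have cl: "closed A" using assms by (simp add: cantor_like_def compact_imp_closed)
  have "A \<inter> {..<cut_point A} = A \<inter> {..cut_point A}" "A \<inter> {cut_point A<..} = A \<inter> {cut_point A..}"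
    using cut(3) by (auto simp: order_less_le)
  then have "closed (A \<inter> {..<cut_point A})" "closed (A \<inter> {cut_point A<..})"
    using cl by (auto intro: closed_Int)
  moreover have "Inf A \<in> A \<inter> {..<cut_point A}" "Sup A \<in> A \<inter> {cut_point A<..}"
    using ends cut by (auto intro: order_less_trans simp: field_simps)
  ultimately show ?thesis
    unfolding half_def using assms cantor_like_Int_open[of A "{..<cut_point A}"]
      cantor_like_Int_open[of A "{cut_point A<..}"] by (cases r) auto
qed

lemma half_dist_le:
  assumes "cantor_like A" and d: "\<And>x y. x \<in> A \<Longrightarrow> y \<in> A \<Longrightarrow> \<bar>x - y\<bar> \<le> d"
    and "x \<in> half A r" "y \<in> half A r"
  shows "\<bar>x - y\<bar> \<le> 2 / 3 * d"
proof -
  note ends = cantor_like_Inf_less_Sup[OF assms(1)] and cut = cut_point[OF assms(1)]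
  have bd: "bdd_below A" "bdd_above A"
    using assms(1) by (auto simp: cantor_like_def compact_imp_bounded bounded_imp_bdd_below bounded_imp_bdd_above)
  have "x \<in> A" "y \<in> A" using assms(3,4) by (auto simp: half_def split: if_splits)
  then have "Inf A \<le> x" "x \<le> Sup A" "Inf A \<le> y" "y \<le> Sup A"
    using bd by (auto intro: cInf_lower cSup_upper)
  moreover have "Sup A - Inf A \<le> d" using d[OF ends(2,1)] by linarith
  moreover have "cut_point A < x \<and> cut_point A < y \<or> x < cut_point A \<and> y < cut_point A"
    using assms(3,4) by (auto simp: half_def split: if_splits)
  ultimately have "x - y \<le> 2 / 3 * d" "y - x \<le> 2 / 3 * d"
    using cut(1,2) by argo+
  then show ?thesis unfolding abs_le_iff by simp
qed

primrec cell :: "real set \<Rightarrow> (nat \<Rightarrow> bool) \<Rightarrow> nat \<Rightarrow> real set" where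
  "cell A w 0 = A"
| "cell A w (Suc n) = half (cell A w n) (w n)"

text \<open>
  The cells around a given point, defined without reference to its code, so that \<open>code\<close> below need
  not be a recursion through its own initial segments.
\<close>

primrec cell_of :: "real set \<Rightarrow> real \<Rightarrow> nat \<Rightarrow> real set" where
  "cell_of A x 0 = A"
| "cell_of A x (Suc n) = half (cell_of A x n) (cut_point (cell_of A x n) < x)"

definition code :: "real set \<Rightarrow> real \<Rightarrow> nat \<Rightarrow> bool" where
  "code A x n \<longleftrightarrow> cut_point (cell_of A x n) < x"

definition point :: "real set \<Rightarrow> (nat \<Rightarrow> bool) \<Rightarrow> real" where
  "point A w = (SOME x. \<forall>n. x \<in> cell A w n)"

lemma half_subset: "half A r \<subseteq> A"
  by (auto simp: half_def)

lemma cantor_like_cell: "cantor_like A \<Longrightarrow> cantor_like (cell A w n)"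
  by (induction n) (auto intro: cantor_like_half)

lemma cell_small:
  assumes "cantor_like A" "e > 0"
  shows "\<exists>n. \<forall>x\<in>cell A w n. \<forall>y\<in>cell A w n. \<bar>x - y\<bar> < e"
proof -
  have "bounded A" using assms by (simp add: cantor_like_def compact_imp_bounded)
  then obtain d where d: "\<And>x y. x \<in> A \<Longrightarrow> y \<in> A \<Longrightarrow> \<bar>x - y\<bar> \<le> d"
    using diameter_bounded_bound[of A] by (metis dist_real_def)
  have small: "\<bar>x - y\<bar> \<le> (2/3) ^ n * d" if "x \<in> cell A w n" "y \<in> cell A w n" for n x y
    using that
  proof (induction n arbitrary: x y)
    case (Suc n)
    have "\<bar>x - y\<bar> \<le> 2 / 3 * ((2/3) ^ n * d)"
      by (rule half_dist_le[OF cantor_like_cell[OF assms(1)]]) (use Suc in auto)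
    then show ?case by simp
  qed (auto intro: d)
  have "(\<lambda>n. (2/3) ^ n * d) \<longlonglongrightarrow> 0"
    by (rule tendsto_mult_left_zero) (simp add: LIMSEQ_power_zero)
  then have "\<forall>\<^sub>F n in sequentially. (2/3) ^ n * d < e"
    using assms(2) by (rule order_tendstoD)
  then obtain n where "(2/3) ^ n * d < e"
    by (auto simp: eventually_sequentially)
  then show ?thesis using small by (meson order_le_less_trans)
qed

lemma cell_decseq: "m \<le> n \<Longrightarrow> cell A w n \<subseteq> cell A w m"
  by (induction n rule: dec_induct) (use half_subset in auto)

lemma Inter_cells:
  assumes "cantor_like A"
  shows "\<Inter>(range (cell A w)) = {point A w}"
proof -
  have "\<exists>a. \<Inter>(range (cell A w)) = {a}"
  proof (rule decreasing_closed_nest_sing)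
    show "closed (cell A w n)" "cell A w n \<noteq> {}" for n
      using cantor_like_cell[OF assms, of w n] by (auto simp: cantor_like_def compact_imp_closed)
  qed (use cell_decseq cell_small[OF assms] in \<open>auto simp: dist_real_def\<close>)
  then obtain a where a: "\<Inter>(range (cell A w)) = {a}" ..
  then have "\<exists>x. \<forall>n. x \<in> cell A w n" by blast
  from someI_ex[OF this] have "\<forall>n. point A w \<in> cell A w n" unfolding point_def .
  then have "point A w \<in> \<Inter>(range (cell A w))" by simp
  then show ?thesis unfolding a by simp
qed

lemma cell_code: "cell A (code A x) n = cell_of A x n"
  by (induction n) (auto simp: code_def)

lemma mem_cell_code:
  assumes "cantor_like A" "x \<in> A"
  shows "x \<in> cell A (code A x) n"
proof (induction n)
  case (Suc n)
  moreover have "x \<noteq> cut_point (cell A (code A x) n)"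
    using Suc cut_point(3)[OF cantor_like_cell[OF assms(1)]] by metis
  ultimately show ?case by (auto simp: half_def code_def[of A x n] cell_code)
qed (use assms in auto)

text \<open>
  A cell remembers the code: the halves are disjoint, so lying in a cell of depth \<open>n\<close> determines the
  first \<open>n\<close> binary choices.
\<close>

lemma code_eqI:
  assumes "x \<in> cell A w n" "i < n"
  shows "w i = code A x i"
proof -
  have eq: "cell A w j = cell_of A x j" if "j \<le> n" for j
    using that
  proof (induction j)
    case (Suc j)
    have "x \<in> cell A w (Suc j)" using cell_decseq[OF Suc(2)] assms(1) by blast
    then show ?case using Suc by (auto simp: half_def split: if_splits)
  qed simp
  have "x \<in> cell A w (Suc i)" using cell_decseq[of "Suc i" n] assms by auto
  then have "x \<in> half (cell_of A x i) (w i)" using eq[of i] assms(2) by simp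
  then show ?thesis unfolding half_def code_def by (cases "w i") auto
qed

lemma cell_cong: "(\<And>i. i < n \<Longrightarrow> w i = v i) \<Longrightarrow> cell A w n = cell A v n"
  by (induction n) auto

lemma point_mem: "cantor_like A \<Longrightarrow> point A w \<in> cell A w n"
  using Inter_cells[of A w] by blast

lemma code_point: "cantor_like A \<Longrightarrow> code A (point A w) = w"
  by (intro ext code_eqI[symmetric, OF _ lessI] point_mem)

lemma point_code: "cantor_like A \<Longrightarrow> x \<in> A \<Longrightarrow> point A (code A x) = x"
  using Inter_cells[of A "code A x"] mem_cell_code[of A x] by (metis INT_I singletonD)

text \<open>
  Cells are relatively open, which is what makes the coding continuous.
\<close>

lemma eventually_cell:
  assumes "cantor_like A" "x \<in> cell A w n"
  shows "\<forall>\<^sub>F y in at x within A. y \<in> cell A w n"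
  using assms(2)
proof (induction n)
  case (Suc n)
  then have ev: "\<forall>\<^sub>F y in at x within A. y \<in> cell A w n" using half_subset by fastforce
  define m where "m = cut_point (cell A w n)"
  let ?U = "if w n then {m<..} else {..<m}"
  have "open ?U" "x \<in> ?U" using Suc.prems by (auto simp: half_def m_def split: if_splits)
  then have "\<forall>\<^sub>F y in at x within A. y \<in> ?U"
    unfolding eventually_at_topological by (intro exI[of _ ?U]) simp
  with ev show ?case by eventually_elim (auto simp: half_def m_def split: if_splits)
qed (simp add: eventually_at_filter)

lemma continuous_on_point_code:
  assumes A: "cantor_like A" and B: "cantor_like B"
  shows "continuous_on A (\<lambda>x. point B (code A x))"
  unfolding continuous_on_def
proof (intro ballI tendstoI)
  fix x e assume x: "x \<in> A" and "0 < (e::real)"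
  then obtain n where n: "\<And>y z. y \<in> cell B (code A x) n \<Longrightarrow> z \<in> cell B (code A x) n \<Longrightarrow> \<bar>y - z\<bar> < e"
    using cell_small[OF B] by meson
  have "\<forall>\<^sub>F y in at x within A. y \<in> cell A (code A x) n"
    by (intro eventually_cell A mem_cell_code x)
  then show "\<forall>\<^sub>F y in at x within A. dist (point B (code A y)) (point B (code A x)) < e"
  proof eventually_elim
    case (elim y)
    then have "cell B (code A x) n = cell B (code A y) n"
      by (intro cell_cong code_eqI)
    then show ?case using n point_mem[OF B] by (metis dist_real_def)
  qed
qed

text \<open>
  Brouwer's characterisation of the Cantor set, for subsets of the line. Both sets are coded by all
  binary sequences, and matching equal codes is continuous in both directions because cells are open
  and shrink to points.
\<close>

theorem cantor_like_homeomorphic: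
  assumes A: "cantor_like A" and B: "cantor_like B"
  shows "A homeomorphic B"
  unfolding homeomorphic_def homeomorphism_def
proof (intro exI conjI)
  let ?f = "\<lambda>x. point B (code A x)" and ?g = "\<lambda>x. point A (code B x)"
  have sub: "point C w \<in> C" if "cantor_like C" for C w
    using point_mem[OF that, of w 0] by simp
  show gf: "\<forall>x\<in>A. ?g (?f x) = x" and fg: "\<forall>y\<in>B. ?f (?g y) = y"
    by (simp_all add: A B code_point point_code)
  show "?f ` A = B" using fg sub[OF A] sub[OF B] by (auto simp: image_iff) metis
  show "?g ` B = A" using gf sub[OF A] sub[OF B] by (auto simp: image_iff) metis
  show "continuous_on A ?f" "continuous_on B ?g"
    by (simp_all add: A B continuous_on_point_code)
qed

lemma cantor_stage_subset: "cantor_stage n \<subseteq> {0..1}"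
  by (induction n) auto

lemma mem_cantor_stage_Suc:
  "x \<in> cantor_stage (Suc n) \<longleftrightarrow>
     x \<le> 1 / 3 \<and> 3 * x \<in> cantor_stage n \<or> 2 / 3 \<le> x \<and> 3 * x - 2 \<in> cantor_stage n"
proof -
  have "x \<in> (\<lambda>x. x / 3) ` cantor_stage n \<longleftrightarrow> 3 * x \<in> cantor_stage n"
    by (force intro: image_eqI[of _ _ "3 * x"])
  moreover have "x \<in> (\<lambda>x. 2 / 3 + x / 3) ` cantor_stage n \<longleftrightarrow> 3 * x - 2 \<in> cantor_stage n"
    by (auto simp: algebra_simps add_divide_distrib diff_divide_distrib intro!: image_eqI[of _ _ "3 * x - 2"])
  moreover have "3 * x \<in> cantor_stage n \<Longrightarrow> x \<le> 1 / 3" "3 * x - 2 \<in> cantor_stage n \<Longrightarrow> 2 / 3 \<le> x"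
    using cantor_stage_subset[of n] by auto
  ultimately show ?thesis by auto
qed

lemma cantor_set_subset: "cantor_set \<subseteq> {0..1}"
  unfolding cantor_set_def using cantor_stage_subset by blast

lemma cantor_set_maps:
  assumes "x \<in> cantor_set"
  shows "x / 3 \<in> cantor_set" "2 / 3 + x / 3 \<in> cantor_set"
proof -
  have "x / 3 \<in> cantor_stage n \<and> 2 / 3 + x / 3 \<in> cantor_stage n" for n
    using assms cantor_set_subset by (cases n) (auto simp: cantor_set_def)
  then show "x / 3 \<in> cantor_set" "2 / 3 + x / 3 \<in> cantor_set" by (auto simp: cantor_set_def)
qed

lemma cantor_set_cases:
  assumes "x \<in> cantor_set"
  obtains y where "y \<in> cantor_set" "x = y / 3 \<or> x = 2 / 3 + y / 3"
proof -
  have x: "x \<in> cantor_stage (Suc n)" for n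
    using assms by (auto simp: cantor_set_def simp del: cantor_stage.simps)
  show thesis
  proof (cases "x \<le> 1 / 3")
    case True
    have "3 * x \<in> cantor_stage n" for n
      using x[of n] True unfolding mem_cantor_stage_Suc by linarith
    then show thesis using that[of "3 * x"] by (auto simp: cantor_set_def)
  next
    case False
    have "3 * x - 2 \<in> cantor_stage n" for n
      using x[of n] False unfolding mem_cantor_stage_Suc by linarith
    then show thesis using that[of "3 * x - 2"] by (auto simp: cantor_set_def diff_divide_distrib)
  qed
qed

lemma cantor_set_ends: "0 \<in> cantor_set" "1 \<in> cantor_set"
proof -
  have "0 \<in> cantor_stage n \<and> 1 \<in> cantor_stage n" for n
    by (induction n) (auto simp: image_iff intro: bexI[of _ 0] bexI[of _ 1])
  then show "0 \<in> cantor_set" "1 \<in> cantor_set" by (auto simp: cantor_set_def)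
qed

text \<open>
  Both \<open>0\<close> and \<open>1\<close> belong to the set, so every point has another one within distance \<open>1\<close>; each of
  the two contractions divides this distance by three.
\<close>

lemma cantor_set_limpt:
  assumes "x \<in> cantor_set"
  shows "x islimpt cantor_set"
proof -
  have near: "\<exists>y\<in>cantor_set. y \<noteq> x \<and> \<bar>y - x\<bar> \<le> (1/3) ^ n" if "x \<in> cantor_set" for n x
    using that
  proof (induction n arbitrary: x)
    case 0
    then have "0 \<le> x" "x \<le> 1" using cantor_set_subset by auto
    then show ?case using cantor_set_ends
      by (intro bexI[of _ "if x = 0 then 1 else 0"]) auto
  next
    case (Suc n)
    obtain x' where x': "x' \<in> cantor_set" "x = x' / 3 \<or> x = 2 / 3 + x' / 3"
      using cantor_set_cases[OF Suc.prems] .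
    obtain y' where y': "y' \<in> cantor_set" "y' \<noteq> x'" "\<bar>y' - x'\<bar> \<le> (1/3) ^ n"
      using Suc.IH[OF x'(1)] by blast
    have "\<bar>y' / 3 - x' / 3\<bar> \<le> (1/3) ^ Suc n"
      using y'(3) by (simp add: abs_if field_simps split: if_splits)
    with x' y' cantor_set_maps[OF y'(1)] show ?case
      by (elim disjE) (force intro: bexI[of _ "y' / 3"], force intro: bexI[of _ "2 / 3 + y' / 3"])
  qed
  show ?thesis unfolding islimpt_approachable
  proof (intro allI impI)
    fix e :: real assume "0 < e"
    then obtain n where "(1/3::real) ^ n < e" using real_arch_pow_inv[of e "1/3"] by auto
    then show "\<exists>y\<in>cantor_set. y \<noteq> x \<and> dist y x < e"
      using near[OF assms, of n] by (auto simp: dist_real_def intro: order_le_less_trans)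
  qed
qed

text \<open>
  An interval in a stage cannot cross the removed middle third, so it comes from an interval of the
  preceding stage by one of the two contractions.
\<close>

lemma cantor_stage_interval:
  assumes "a \<le> b" "{a..b} \<subseteq> cantor_stage n"
  shows "b - a \<le> (1/3) ^ n"
  using assms
proof (induction n arbitrary: a b)
  case (Suc n)
  have split: "3 * x \<in> cantor_stage n \<and> x \<le> 1/3 \<or> 3 * x - 2 \<in> cantor_stage n \<and> 2/3 \<le> x" if "x \<in> {a..b}" for x
    using that Suc.prems(2) mem_cantor_stage_Suc[of x n] by blast
  show ?case
  proof (cases "b \<le> 1/3")
    case True
    have "{3*a..3*b} \<subseteq> cantor_stage n"
    proof
      fix y assume "y \<in> {3*a..3*b}"
      then show "y \<in> cantor_stage n" using split[of "y/3"] True by auto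
    qed
    then show ?thesis using Suc.IH[of "3*a" "3*b"] Suc.prems(1) by simp
  next
    case False
    have "a > 1/3"
    proof (rule ccontr)
      assume a: "\<not> a > 1/3"
      obtain m where "1/3 < m" "m < min b (2/3)" using dense[of "1/3" "min b (2/3)"] False by auto
      then show False using split[of m] a by auto
    qed
    have "{3*a-2..3*b-2} \<subseteq> cantor_stage n"
    proof
      fix y assume "y \<in> {3*a-2..3*b-2}"
      moreover have y: "y = 3 * ((y+2)/3) - 2" by (simp add: field_simps)
      ultimately show "y \<in> cantor_stage n"
        using split[of "(y+2)/3"] \<open>a > 1/3\<close> unfolding y[symmetric] by auto
    qed
    then show ?thesis using Suc.IH[of "3*a-2" "3*b-2"] Suc.prems(1) by simp
  qed
qed auto

lemma cantor_like_cantor_set: "cantor_like cantor_set"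
  unfolding cantor_like_def
proof (intro conjI ballI)
  have "compact (cantor_stage n)" for n
    by (induction n) (auto intro!: compact_Un compact_continuous_image continuous_intros)
  then show "compact cantor_set" unfolding cantor_set_def
    by (intro compact_Inter) auto
  show "cantor_set \<noteq> {}" using cantor_set_ends by auto
  show "x islimpt cantor_set" if "x \<in> cantor_set" for x by (rule cantor_set_limpt[OF that])
  show "interior cantor_set = {}"
  proof (rule ccontr)
    assume "interior cantor_set \<noteq> {}"
    then obtain x e where e: "0 < e" "cball x e \<subseteq> cantor_set"
      by (metis ex_in_conv mem_interior_cball)
    obtain n where n: "(1/3::real) ^ n < e" using real_arch_pow_inv[of e "1/3"] e by auto
    have "{x - e..x + e} \<subseteq> cantor_stage n" using e(2) by (auto simp: cantor_set_def cball_eq_atLeastAtMost)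
    then show False using cantor_stage_interval[of "x - e" "x + e" n] e(1) n by simp
  qed
qed

section \<open>Reflection of the unit interval\<close>

text \<open>
  Conjugation by \<open>x \<mapsto> 1 - x\<close> exchanges the roles of \<open>f\<close> and \<open>g\<close>.
\<close>

definition reflect :: "(real \<Rightarrow> real) \<Rightarrow> real \<Rightarrow> real" where
  "reflect h x = 1 - h (1 - x)"

definition mirror :: "real set \<Rightarrow> real set" where
  "mirror A = {x. 1 - x \<in> A}"

lemma mem_mirror [simp]: "x \<in> mirror A \<longleftrightarrow> 1 - x \<in> A"
  by (simp add: mirror_def)

lemma mirror_mirror [simp]: "mirror (mirror A) = A"
  by auto

lemma funpow_reflect: "(reflect h ^^ n) x = 1 - (h ^^ n) (1 - x)"
  by (induction n) (auto simp: reflect_def)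

lemma mirror_eq_image: "mirror A = (\<lambda>x. 1 - x) ` A"
proof
  show "mirror A \<subseteq> (\<lambda>x. 1 - x) ` A" by (auto intro!: image_eqI[of _ _ "1 - _"])
qed auto

lemma mirror_Int: "mirror (A \<inter> B) = mirror A \<inter> mirror B"
  by auto

lemma countable_mirror [simp]: "countable (mirror A) \<longleftrightarrow> countable A"
proof
  show "countable (mirror A)" if "countable A" for A
    unfolding mirror_eq_image using that by simp
  from this[of "mirror A"] show "countable A" if "countable (mirror A)" using that by simp
qed

lemma image_reflect: "reflect h ` mirror A = mirror (h ` A)"
proof -
  have "reflect h ` mirror A = (\<lambda>x. 1 - x) ` h ` (\<lambda>x. 1 - x) ` mirror A"
    by (simp add: reflect_def image_image)
  also have "\<dots> = mirror (h ` A)" by (simp flip: mirror_eq_image)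
  finally show ?thesis .
qed

lemma image_reflect_orbit: "(\<Union>j. (reflect h ^^ j) ` mirror A) = mirror (\<Union>j. (h ^^ j) ` A)"
proof -
  have "(reflect h ^^ j) ` mirror A = mirror ((h ^^ j) ` A)" for j
    using image_reflect[of "h ^^ j" A] by (simp add: funpow_reflect reflect_def)
  then have "(\<Union>j. (reflect h ^^ j) ` mirror A) = (\<Union>j. mirror ((h ^^ j) ` A))" by simp
  also have "\<dots> = mirror (\<Union>j. (h ^^ j) ` A)" unfolding mirror_def by blast
  finally show ?thesis .
qed

lemma mirror_open_interval: "{a<..<b} \<subseteq> A \<Longrightarrow> {1 - b<..<1 - a} \<subseteq> mirror A"
  by (force simp: subset_iff)

lemma open_mirror: "open A \<Longrightarrow> open (mirror A)"
  using open_vimage[of A "\<lambda>x. 1 - x"] by (simp add: mirror_def vimage_def continuous_intros)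

lemma closed_mirror: "closed A \<Longrightarrow> closed (mirror A)"
  using closed_vimage[of A "\<lambda>x. 1 - x"] by (simp add: mirror_def vimage_def continuous_intros)

lemma interior_mirror: "interior (mirror A) = mirror (interior A)"
proof -
  have le: "mirror (interior B) \<subseteq> interior (mirror B)" for B
    by (intro interior_maximal open_mirror) (auto dest: subsetD[OF interior_subset])
  show ?thesis using le[of A] le[of "mirror A"] by fastforce
qed

section \<open>Pairs fixing the end points\<close>

text \<open>
  This is how points that might land on the end points of a hole are disposed of: only countably many
  do, and an open set is not made of them.
\<close>

lemma open_subset_countable_eq_empty:
  fixes A :: "real set" assumes "open U" "U \<subseteq> A" "countable A" shows "U = {}"
proof (rule ccontr)
  assume "U \<noteq> {}"
  then obtain x e where "e > 0" "ball x e \<subseteq> U" using assms(1) by (metis ex_in_conv openE)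
  then have "{x - e<..<x + e} \<subseteq> A" using assms(2) by (auto simp: ball_eq_greaterThanLessThan)
  then show False using \<open>e > 0\<close> assms(3) uncountable_open_interval[of "x - e" "x + e"]
    by (auto dest: countable_subset)
qed

text \<open>
  The orbit decreases, and its limit is a fixed point of \<open>h\<close>.
\<close>

lemma funpow_tendsto_0:
  fixes h :: "real \<Rightarrow> real"
  assumes cont: "continuous_on {0..1} h" and maps: "\<And>x. x \<in> {0..1} \<Longrightarrow> h x \<in> {0..1}"
    and h0: "h 0 = 0" and below: "\<And>x. 0 < x \<Longrightarrow> x \<le> 1 \<Longrightarrow> h x < x" and x: "x \<in> {0..1}"
  shows "(\<lambda>n. (h ^^ n) x) \<longlonglongrightarrow> 0"
proof -
  have mem: "(h ^^ n) x \<in> {0..1}" for n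
    by (induction n) (use x maps in auto)
  have le: "h y \<le> y" if "y \<in> {0..1}" for y
    using below[of y] h0 that by (cases "y = 0") (auto simp: less_imp_le)
  have "decseq (\<lambda>n. (h ^^ n) x)"
    by (rule decseq_SucI) (use le mem in auto)
  then obtain L where L: "(\<lambda>n. (h ^^ n) x) \<longlonglongrightarrow> L"
    using decseq_convergent[of "\<lambda>n. (h ^^ n) x" 0] mem by (metis atLeastAtMost_iff)
  have L01: "L \<in> {0..1}"
    using closed_sequentially[OF closed_atLeastAtMost _ L, of 0 1] mem by auto
  have "(\<lambda>n. h ((h ^^ n) x)) \<longlonglongrightarrow> h L"
    by (rule continuous_on_tendsto_compose[OF cont L L01]) (use mem in auto)
  moreover have "(\<lambda>n. h ((h ^^ n) x)) \<longlonglongrightarrow> L" using LIMSEQ_Suc[OF L] by simp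
  ultimately have "h L = L" using LIMSEQ_unique by blast
  then have "L = 0" using below[of L] L01 by force
  with L show ?thesis by simp
qed

locale interval_pair =
  fixes f g :: "real \<Rightarrow> real"
  assumes mono_f: "strict_mono_on {0..1} f" and mono_g: "strict_mono_on {0..1} g"
    and cont_f: "continuous_on {0..1} f" and cont_g: "continuous_on {0..1} g"
    and f_0: "f 0 = 0" and g_1: "g 1 = 1"
    and f_below: "0 < x \<Longrightarrow> x \<le> 1 \<Longrightarrow> f x < x"
    and g_above: "0 \<le> x \<Longrightarrow> x < 1 \<Longrightarrow> x < g x"
begin

lemma f_less_iff: "x \<in> {0..1} \<Longrightarrow> y \<in> {0..1} \<Longrightarrow> f x < f y \<longleftrightarrow> x < y"
  by (rule strict_mono_on_less[OF mono_f])

lemma g_less_iff: "x \<in> {0..1} \<Longrightarrow> y \<in> {0..1} \<Longrightarrow> g x < g y \<longleftrightarrow> x < y"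
  by (rule strict_mono_on_less[OF mono_g])

lemma f_le_iff: "x \<in> {0..1} \<Longrightarrow> y \<in> {0..1} \<Longrightarrow> f x \<le> f y \<longleftrightarrow> x \<le> y"
  by (rule strict_mono_on_less_eq[OF mono_f])

lemma g_le_iff: "x \<in> {0..1} \<Longrightarrow> y \<in> {0..1} \<Longrightarrow> g x \<le> g y \<longleftrightarrow> x \<le> y"
  by (rule strict_mono_on_less_eq[OF mono_g])

lemma g_0_pos: "0 < g 0" using g_above[of 0] by simp
lemma f_1_less: "f 1 < 1" using f_below[of 1] by simp
lemma g_0_less: "g 0 < 1" using g_less_iff[of 0 1] g_1 by simp

lemma f_mem: "x \<in> {0..1} \<Longrightarrow> f x \<in> {0..f 1}"
  using f_le_iff[of 0 x] f_le_iff[of x 1] f_0 by auto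

lemma g_mem: "x \<in> {0..1} \<Longrightarrow> g x \<in> {g 0..1}"
  using g_le_iff[of 0 x] g_le_iff[of x 1] g_1 by auto

lemma f_mem': "x \<in> {0..1} \<Longrightarrow> f x \<in> {0..1}"
  using f_mem[of x] f_1_less by auto

lemma g_mem': "x \<in> {0..1} \<Longrightarrow> g x \<in> {0..1}"
  using g_mem[of x] g_0_pos by auto

lemma funpow_f_mem: "x \<in> {0..1} \<Longrightarrow> (f ^^ n) x \<in> {0..1}"
  by (induction n) (use f_mem' in auto)

lemma funpow_g_mem: "x \<in> {0..1} \<Longrightarrow> (g ^^ n) x \<in> {0..1}"
  by (induction n) (use g_mem' in auto)

lemma funpow_g_less_iff: "x \<in> {0..1} \<Longrightarrow> y \<in> {0..1} \<Longrightarrow> (g ^^ n) x < (g ^^ n) y \<longleftrightarrow> x < y"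
  by (induction n) (use g_less_iff funpow_g_mem in auto)

lemma funpow_f_less_iff: "x \<in> {0..1} \<Longrightarrow> y \<in> {0..1} \<Longrightarrow> (f ^^ n) x < (f ^^ n) y \<longleftrightarrow> x < y"
  by (induction n) (use f_less_iff funpow_f_mem in auto)

lemma cont_funpow_g: "continuous_on {0..1} (g ^^ n)"
proof (induction n)
  case (Suc n)
  show ?case unfolding funpow.simps
    by (rule continuous_on_compose[OF Suc continuous_on_subset[OF cont_g]]) (use funpow_g_mem in auto)
qed (simp add: id_def continuous_on_id)

lemma mirror_interval_pair: "interval_pair (reflect g) (reflect f)"
proof
  show "strict_mono_on {0..1} (reflect f)" "strict_mono_on {0..1} (reflect g)"
    using mono_f mono_g by (auto simp: strict_mono_on_def reflect_def)
  show "continuous_on {0..1} (reflect f)" "continuous_on {0..1} (reflect g)"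
    unfolding reflect_def
    by (intro continuous_intros continuous_on_compose2[OF cont_f] continuous_on_compose2[OF cont_g]; auto)+
  show "reflect g x < x" if "0 < x" "x \<le> 1" for x
    using g_above[of "1 - x"] that by (simp add: reflect_def)
  show "x < reflect f x" if "0 \<le> x" "x < 1" for x
    using f_below[of "1 - x"] that by (simp add: reflect_def)
qed (use f_0 g_1 in \<open>auto simp: reflect_def\<close>)

lemma funpow_f_tendsto_0: "x \<in> {0..1} \<Longrightarrow> (\<lambda>n. (f ^^ n) x) \<longlonglongrightarrow> 0"
  by (rule funpow_tendsto_0[OF cont_f f_mem' f_0 f_below])

end

context interval_pair
begin

interpretation mir: interval_pair "reflect g" "reflect f"
  by (rule mirror_interval_pair)

lemma funpow_g_tendsto_1: "x \<in> {0..1} \<Longrightarrow> (\<lambda>n. (g ^^ n) x) \<longlonglongrightarrow> 1"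
  using mir.funpow_f_tendsto_0[of "1 - x"] tendsto_diff[OF tendsto_const, of "\<lambda>n. 1 - (g ^^ n) x" 0 sequentially 1]
  by (simp add: funpow_reflect)

end

section \<open>Expansion of intervals contained in an invariant set\<close>

text \<open>
  \<open>K\<close> stands for the minimal set. It may touch the end points of the holes, hence the countability in
  place of disjointness. The last four assumptions are castration and eventual expansion with the
  inverse branches unfolded: \<open>f \<circ> g\<^sup>j\<close> on \<open>[g 0, g (g 0)]\<close> inverts the \<open>j\<close>-th branch of \<open>\<F>\<close>, and the
  side condition \<open>f (f 1) \<le> f (g\<^sup>j p)\<close> says that the interval lies in the domain of \<open>\<F>\<close>.
\<close>

locale holed_pair = interval_pair f g for f g +
  fixes Hf Hg K :: "real set" and \<mu> :: real
  assumes overlap: "g 0 < f 1" and ff_1: "f (f 1) < g 0" and gg_0: "f 1 < g (g 0)"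
    and Hf: "Hf \<subseteq> {0..<g 0}" and Hg: "Hg \<subseteq> {f 1<..1}"
    and K_closed: "closed K" and K_01: "K \<subseteq> {0..1}" and K_eq: "K = f ` K \<union> g ` K"
    and K_Hf: "countable (K \<inter> Hf)" and K_Hg: "countable (K \<inter> Hg)"
    and int_K_Hf: "interior K \<inter> Hf = {}" and int_K_Hg: "interior K \<inter> Hg = {}"
    and castration: "{g 0..f 1} \<subseteq> interior (f ` (\<Union>j. (g ^^ j) ` Hg)) \<union> interior (g ` (\<Union>j. (f ^^ j) ` Hf))"
    and mu: "1 < \<mu>"
    and expand_f: "f (f 1) \<le> f ((g ^^ j) p) \<Longrightarrow> g 0 \<le> p \<Longrightarrow> p < q \<Longrightarrow> q \<le> g (g 0) \<Longrightarrow>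
      {f ((g ^^ j) p)<..<f ((g ^^ j) q)} \<inter> Hf = {} \<Longrightarrow>
      \<mu> * (f ((g ^^ j) q) - f ((g ^^ j) p)) \<le> q - p"
    and expand_g: "g ((f ^^ j) q) \<le> g (g 0) \<Longrightarrow> f (f 1) \<le> p \<Longrightarrow> p < q \<Longrightarrow> q \<le> f 1 \<Longrightarrow>
      {g ((f ^^ j) p)<..<g ((f ^^ j) q)} \<inter> Hg = {} \<Longrightarrow>
      \<mu> * (g ((f ^^ j) q) - g ((f ^^ j) p)) \<le> q - p"
begin

lemma mirror_holed_pair:
  "holed_pair (reflect g) (reflect f) (mirror Hg) (mirror Hf) (mirror K) \<mu>"
proof (intro holed_pair.intro holed_pair_axioms.intro mirror_interval_pair)
  show "closed (mirror K)" by (rule closed_mirror[OF K_closed])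
  show "mirror K = reflect g ` mirror K \<union> reflect f ` mirror K"
    unfolding image_reflect by (subst K_eq) auto
  show "countable (mirror K \<inter> mirror Hf)" "countable (mirror K \<inter> mirror Hg)"
    using K_Hf K_Hg by (simp_all flip: mirror_Int)
  show "{reflect f 0..reflect g 1} \<subseteq> interior (reflect g ` (\<Union>j. (reflect f ^^ j) ` mirror Hf)) \<union>
      interior (reflect f ` (\<Union>j. (reflect g ^^ j) ` mirror Hg))"
    unfolding image_reflect image_reflect_orbit interior_mirror
  proof
    fix x assume "x \<in> {reflect f 0..reflect g 1}"
    then have "1 - x \<in> {g 0..f 1}" by (auto simp: reflect_def)
    then show "x \<in> mirror (interior (g ` (\<Union>j. (f ^^ j) ` Hf))) \<union> mirror (interior (f ` (\<Union>j. (g ^^ j) ` Hg)))"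
      using castration by auto
  qed
  have mirror_ivl: "{1 - b<..<1 - a} \<inter> H = {}" if "{a<..<b} \<inter> mirror H = {}" for a b H
  proof (rule ccontr)
    assume "{1 - b<..<1 - a} \<inter> H \<noteq> {}"
    then obtain x where "1 - b < x" "x < 1 - a" "x \<in> H" by auto
    then have "1 - x \<in> {a<..<b} \<inter> mirror H" by simp
    with that show False by blast
  qed
  show "\<mu> * (reflect g ((reflect f ^^ j) q) - reflect g ((reflect f ^^ j) p)) \<le> q - p"
    if "reflect g (reflect g 1) \<le> reflect g ((reflect f ^^ j) p)" "reflect f 0 \<le> p" "p < q"
      "q \<le> reflect f (reflect f 0)" "{reflect g ((reflect f ^^ j) p)<..<reflect g ((reflect f ^^ j) q)} \<inter> mirror Hg = {}" for j p q
    using expand_g[of j "1 - p" "1 - q"] that(1-4) mirror_ivl[OF that(5)]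
    by (simp add: reflect_def funpow_reflect)
  show "\<mu> * (reflect f ((reflect g ^^ j) q) - reflect f ((reflect g ^^ j) p)) \<le> q - p"
    if "reflect f ((reflect g ^^ j) q) \<le> reflect f (reflect f 0)" "reflect g (reflect g 1) \<le> p" "p < q"
      "q \<le> reflect g 1" "{reflect f ((reflect g ^^ j) p)<..<reflect f ((reflect g ^^ j) q)} \<inter> mirror Hf = {}" for j p q
    using expand_f[of j "1 - q" "1 - p"] that(1-4) mirror_ivl[OF that(5)]
    by (simp add: reflect_def funpow_reflect)
qed (use overlap ff_1 gg_0 Hf Hg K_01 int_K_Hf int_K_Hg mu in \<open>auto simp: reflect_def interior_mirror\<close>)

lemma mem_of_g_mem:
  assumes "x \<in> {0..1}" "g x \<in> K" "g x \<notin> f ` K" shows "x \<in> K"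
proof -
  from assms obtain k where k: "k \<in> K" "g x = g k" using K_eq by blast
  then have "x = k" using K_01 assms(1) g_less_iff by (metis linorder_neq_iff subsetD)
  with k show ?thesis by simp
qed

lemma mem_of_g_mem_above: "x \<in> {0..1} \<Longrightarrow> f 1 < g x \<Longrightarrow> g x \<in> K \<Longrightarrow> x \<in> K"
  using mem_of_g_mem[of x] f_mem K_01 by fastforce

text \<open>
  Above \<open>f 1\<close> a point of \<open>K\<close> can only come from \<open>g\<close>. All iterates of \<open>x \<ge> g 0\<close> except \<open>x\<close> itself
  are at least \<open>g (g 0) > f 1\<close>, so the orbit segment can be run backwards inside \<open>K\<close>.
\<close>

lemma mem_of_funpow_g_mem:
  "g 0 \<le> x \<Longrightarrow> x \<le> 1 \<Longrightarrow> (g ^^ j) x \<in> K \<Longrightarrow> x \<in> K"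
proof (induction j)
  case (Suc j)
  have x: "x \<in> {0..1}" using Suc.prems g_0_pos by auto
  have "g 0 \<le> (g ^^ j) x"
  proof (cases j)
    case (Suc i)
    then show ?thesis using g_mem[OF funpow_g_mem[OF x, of i]] by simp
  qed (use Suc in simp)
  then have "g (g 0) \<le> (g ^^ Suc j) x"
    using g_le_iff[of "g 0" "(g ^^ j) x"] funpow_g_mem[OF x, of j] g_0_pos g_0_less by simp
  then have "(g ^^ j) x \<in> K"
    using mem_of_g_mem_above[of "(g ^^ j) x"] funpow_g_mem[OF x, of j] Suc.prems gg_0 by simp
  with Suc show ?case by simp
qed simp

text \<open>
  If \<open>f (g\<^sup>j h)\<close> with \<open>h \<in> H\<^sub>g\<close> is the image under \<open>f\<close> of a point of \<open>K\<close>, then running backwards gives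
  \<open>h \<in> K\<close>, which is possible for countably many \<open>h\<close> only. So on the castrated part the branch through
  \<open>f\<close> contributes next to nothing to \<open>K\<close>.
\<close>

lemma countable_f_castrated: "countable (f ` K \<inter> f ` (\<Union>j. (g ^^ j) ` Hg))"
proof -
  have "f ` K \<inter> f ` (\<Union>j. (g ^^ j) ` Hg) \<subseteq> f ` (\<Union>j. (g ^^ j) ` (K \<inter> Hg))"
  proof
    fix y assume "y \<in> f ` K \<inter> f ` (\<Union>j. (g ^^ j) ` Hg)"
    then obtain k j h where y: "y = f k" "k \<in> K" "y = f ((g ^^ j) h)" "h \<in> Hg" by blast
    have h: "g 0 \<le> h" "h \<le> 1" using Hg y(4) overlap by auto
    then have "(g ^^ j) h \<in> {0..1}" using g_0_pos by (intro funpow_g_mem) auto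
    then have "(g ^^ j) h = k" using y K_01 f_less_iff by (metis linorder_neq_iff subsetD)
    then have "h \<in> K" using mem_of_funpow_g_mem[OF h, of j] y(2) by simp
    then show "y \<in> f ` (\<Union>j. (g ^^ j) ` (K \<inter> Hg))" using y by blast
  qed
  moreover have "countable (f ` (\<Union>j. (g ^^ j) ` (K \<inter> Hg)))" using K_Hg by auto
  ultimately show ?thesis by (rule countable_subset)
qed

text \<open>
  Castration must cover \<open>g 0\<close> by the part belonging to \<open>f\<close>, since the other part lies in the image of
  \<open>g\<close> and so to the right of \<open>g 0\<close>. Immediately to the left of \<open>g 0\<close>, points of \<open>K\<close> come from \<open>f\<close> and
  lie in the castrated part of \<open>f\<close>: there are countably many.
\<close>

lemma g_0_notin_interior: "g 0 \<notin> interior K"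
proof
  assume g0: "g 0 \<in> interior K"
  let ?Rf = "f ` (\<Union>j. (g ^^ j) ` Hg)" and ?Rg = "g ` (\<Union>j. (f ^^ j) ` Hf)"
  define V where "V = interior ?Rf \<inter> interior K"
  have left: "\<exists>y\<in>U. y < g 0" if U: "open U" "g 0 \<in> U" for U
  proof -
    obtain e where "e > 0" "ball (g 0) e \<subseteq> U" using U openE by blast
    then show ?thesis by (intro bexI[of _ "g 0 - e / 2"]) (auto simp: dist_real_def)
  qed
  have Rg: "g 0 \<le> y" if y: "y \<in> ?Rg" for y
  proof -
    obtain j h where h: "h \<in> Hf" "y = g ((f ^^ j) h)" using y by blast
    then have "h \<in> {0..1}" using Hf g_0_less by force
    then show ?thesis using h g_mem[OF funpow_f_mem[of h j]] by simp
  qed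
  have "g 0 \<notin> interior ?Rg"
  proof
    assume "g 0 \<in> interior ?Rg"
    then obtain y where "y \<in> interior ?Rg" "y < g 0" using left open_interior by blast
    then show False using Rg[of y] subsetD[OF interior_subset] by (meson linorder_not_less)
  qed
  moreover have "g 0 \<in> interior ?Rf \<union> interior ?Rg"
    using subsetD[OF castration, of "g 0"] overlap by simp
  ultimately have "g 0 \<in> V" using g0 unfolding V_def by blast
  have "open (V \<inter> {..<g 0})" by (simp add: V_def open_Int)
  moreover have "V \<inter> {..<g 0} \<noteq> {}" using left[of V] \<open>g 0 \<in> V\<close> by (auto simp: V_def)
  moreover have "V \<inter> {..<g 0} \<subseteq> f ` K \<inter> ?Rf"
  proof
    fix y assume y: "y \<in> V \<inter> {..<g 0}"
    then have "y \<in> K" "y \<in> ?Rf" using interior_subset unfolding V_def by blast+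
    moreover have "y \<notin> g ` K" using y g_mem K_01 by (fastforce simp: subset_iff)
    ultimately show "y \<in> f ` K \<inter> ?Rf" using K_eq by blast
  qed
  ultimately show False
    using open_subset_countable_eq_empty countable_f_castrated by blast
qed

lemma g_interior:
  assumes "0 < y" "y < 1" "f 1 < g y" "g y \<in> interior K"
  shows "y \<in> interior K"
proof -
  have "open ({0<..<1} \<inter> g -` (interior K \<inter> {f 1<..}))"
    by (rule continuous_open_preimage[OF continuous_on_subset[OF cont_g]]) auto
  moreover have "{0<..<1} \<inter> g -` (interior K \<inter> {f 1<..}) \<subseteq> K"
    using mem_of_g_mem_above by (auto dest: subsetD[OF interior_subset])
  ultimately have "{0<..<1} \<inter> g -` (interior K \<inter> {f 1<..}) \<subseteq> interior K"
    by (intro interior_maximal)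
  moreover have "y \<in> {0<..<1} \<inter> g -` (interior K \<inter> {f 1<..})" using assms by simp
  ultimately show ?thesis by blast
qed

lemma funpow_g_bounds: "0 < (g ^^ n) (g 0)" "(g ^^ n) (g 0) < 1"
proof -
  show "(g ^^ n) (g 0) < 1"
  proof (induction n)
    case (Suc n)
    then show ?case using g_less_iff[of "(g ^^ n) (g 0)" 1] funpow_g_mem[of "g 0" n] g_0_pos g_0_less g_1 by simp
  qed (use g_0_less in simp)
  show "0 < (g ^^ n) (g 0)"
    using funpow_g_mem[of "g 0" n] g_mem[OF funpow_g_mem[of 0 n]] g_0_pos
    by (simp add: funpow_swap1[symmetric])
qed

lemma funpow_g_notin_interior: "(g ^^ n) (g 0) \<notin> interior K"
proof (induction n)
  case (Suc n)
  have "g (g 0) \<le> g ((g ^^ n) (g 0))"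
    using g_le_iff[of "g 0" "(g ^^ n) (g 0)"] funpow_g_bounds[of n] g_mem[OF funpow_g_mem[of 0 n]] g_0_pos g_0_less
    by (simp add: funpow_swap1[symmetric])
  then have "f 1 < g ((g ^^ n) (g 0))" using gg_0 by simp
  then show ?case using g_interior[OF funpow_g_bounds[of n]] Suc by auto
qed (simp add: g_0_notin_interior)

text \<open>
  The points \<open>g\<^sup>n (g 0)\<close> increase to \<open>1\<close> and do not lie in the interior of \<open>K\<close>, so the interval fits
  between two consecutive ones and is the image of an interval of the fundamental domain
  \<open>[g 0, g (g 0)]\<close> under a single power of \<open>g\<close>.
\<close>

lemma pull_back_by_funpow_g:
  assumes "{c<..<d} \<subseteq> K" "g 0 \<le> c" "c < d" "d \<le> 1"
  obtains j p q where "c = (g ^^ j) p" "d = (g ^^ j) q" "g 0 \<le> p" "p < q" "q \<le> g (g 0)" "{p<..<q} \<subseteq> K"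
proof -
  have "\<forall>\<^sub>F n in sequentially. c < (g ^^ n) (g 0)"
    using funpow_g_tendsto_1[of "g 0"] by (rule order_tendstoD) (use assms g_0_pos in auto)
  then have ex: "\<exists>n. c < (g ^^ n) (g 0)" by (auto simp: eventually_sequentially)
  define N where "N = (LEAST n. c < (g ^^ n) (g 0))"
  have N: "c < (g ^^ N) (g 0)" unfolding N_def by (rule LeastI_ex[OF ex])
  have "N \<noteq> 0" using N assms(2) by (cases N) auto
  then obtain j where j: "N = Suc j" using not0_implies_Suc by blast
  have low: "(g ^^ j) (g 0) \<le> c"
    using not_less_Least[of j "\<lambda>n. c < (g ^^ n) (g 0)"] j by (simp add: N_def)
  have high: "c < (g ^^ j) (g (g 0))" using N j by (simp add: funpow_swap1)
  have d_le: "d \<le> (g ^^ j) (g (g 0))"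
  proof (rule ccontr)
    assume "\<not> ?thesis"
    then have "(g ^^ N) (g 0) \<in> {c<..<d}" using high j by (simp add: funpow_swap1)
    moreover have "{c<..<d} \<subseteq> interior K" using assms(1) by (rule interior_maximal) simp
    ultimately show False using funpow_g_notin_interior by blast
  qed
  have g01: "g 0 \<in> {0..1}" "g (g 0) \<in> {0..1}" "g 0 \<le> g (g 0)"
    using g_mem'[of 0] g_mem'[of "g 0"] g_mem[of "g 0"] by auto
  have cont: "continuous_on {g 0..g (g 0)} (g ^^ j)"
    by (rule continuous_on_subset[OF cont_funpow_g]) (use g01 in auto)
  obtain p where p: "g 0 \<le> p" "p \<le> g (g 0)" "(g ^^ j) p = c"
    using IVT'[OF low less_imp_le[OF high] g01(3) cont] by blast
  obtain q where q: "g 0 \<le> q" "q \<le> g (g 0)" "(g ^^ j) q = d"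
    using IVT'[of "g ^^ j" "g 0" d "g (g 0)"] low assms(3) d_le g01(3) cont by force
  have mem: "p \<in> {0..1}" "q \<in> {0..1}" using p q g01 by auto
  have "p < q" using funpow_g_less_iff[OF mem, of j] p q assms(3) by simp
  moreover have "{p<..<q} \<subseteq> K"
  proof
    fix x assume x: "x \<in> {p<..<q}"
    then have "x \<in> {0..1}" "g 0 \<le> x" using mem p by auto
    moreover have "(g ^^ j) x \<in> {c<..<d}"
      using x funpow_g_less_iff[of p x j] funpow_g_less_iff[of x q j] mem p q \<open>x \<in> {0..1}\<close> by auto
    ultimately show "x \<in> K" using mem_of_funpow_g_mem[of x j] assms(1) by auto
  qed
  ultimately show thesis using that p q by blast
qed

lemma expand_through_f:
  assumes "{a<..<b} \<subseteq> f ` K" "f (f 1) \<le> a" "a < b" "b \<le> f 1"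
  obtains p q where "g 0 \<le> p" "p < q" "q \<le> g (g 0)" "{p<..<q} \<subseteq> K" "\<mu> * (b - a) \<le> q - p"
proof -
  have f1: "f 1 \<in> {0..1}" using f_mem'[of 1] by simp
  have cont: "continuous_on {f 1..1} f" by (rule continuous_on_subset[OF cont_f]) (use f1 in auto)
  obtain c where c: "f 1 \<le> c" "c \<le> 1" "f c = a"
    using IVT'[of f "f 1" a 1] assms cont f1 by force
  obtain d where d: "f 1 \<le> d" "d \<le> 1" "f d = b"
    using IVT'[of f "f 1" b 1] assms cont f1 by force
  have mem: "c \<in> {0..1}" "d \<in> {0..1}" using c d f1 by auto
  have "c < d" using f_less_iff[OF mem] c d assms by simp
  have "{c<..<d} \<subseteq> K"
  proof
    fix x assume x: "x \<in> {c<..<d}"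
    then have x01: "x \<in> {0..1}" using mem by auto
    then have "f x \<in> {a<..<b}" using x f_less_iff[of c x] f_less_iff[of x d] mem c d by auto
    then obtain k where "k \<in> K" "f x = f k" using assms(1) by blast
    then show "x \<in> K" using f_less_iff[OF x01, of k] f_less_iff[of k x] x01 K_01 by (metis linorder_neq_iff subsetD)
  qed
  from pull_back_by_funpow_g[OF this _ \<open>c < d\<close> d(2)] c(1) overlap
  obtain j p q where jpq: "c = (g ^^ j) p" "d = (g ^^ j) q" "g 0 \<le> p" "p < q" "q \<le> g (g 0)" "{p<..<q} \<subseteq> K"
    by auto
  have "{a<..<b} \<subseteq> interior K"
    using assms(1) K_eq by (intro interior_maximal) auto
  then have "{a<..<b} \<inter> Hf = {}" using int_K_Hf by blast
  then have "\<mu> * (b - a) \<le> q - p"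
    using expand_f[of j p q] jpq c d assms(2) by simp
  then show thesis using that jpq by blast
qed

end

context holed_pair
begin

interpretation mir: holed_pair "reflect g" "reflect f" "mirror Hg" "mirror Hf" "mirror K" \<mu>
  by (rule mirror_holed_pair)

lemma f_1_notin_interior: "f 1 \<notin> interior K"
  using mir.g_0_notin_interior by (simp add: reflect_def interior_mirror)

lemma countable_g_castrated: "countable (g ` K \<inter> g ` (\<Union>j. (f ^^ j) ` Hf))"
proof -
  have "countable (mirror (g ` K) \<inter> mirror (g ` (\<Union>j. (f ^^ j) ` Hf)))"
    using mir.countable_f_castrated unfolding image_reflect image_reflect_orbit .
  then show ?thesis unfolding mirror_Int[symmetric] by simp
qed

lemma pull_back_by_funpow_f:
  assumes "{c<..<d} \<subseteq> K" "0 \<le> c" "c < d" "d \<le> f 1"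
  obtains p q where "f (f 1) \<le> p" "p < q" "q \<le> f 1" "{p<..<q} \<subseteq> K"
proof -
  have "reflect f 0 \<le> 1 - d" "1 - d < 1 - c" "1 - c \<le> 1"
    using assms(2-4) by (auto simp: reflect_def)
  from mir.pull_back_by_funpow_g[OF mirror_open_interval[OF assms(1)] this]
  obtain p q where "reflect f 0 \<le> p" "p < q" "q \<le> reflect f (reflect f 0)" "{p<..<q} \<subseteq> mirror K"
    by metis
  then show thesis
    using that[of "1 - q" "1 - p"] mirror_open_interval[of p q "mirror K"] by (simp add: reflect_def)
qed

lemma expand_through_g:
  assumes "{a<..<b} \<subseteq> g ` K" "g 0 \<le> a" "a < b" "b \<le> g (g 0)"
  obtains p q where "f (f 1) \<le> p" "p < q" "q \<le> f 1" "{p<..<q} \<subseteq> K" "\<mu> * (b - a) \<le> q - p"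
proof -
  have "{1 - b<..<1 - a} \<subseteq> reflect g ` mirror K"
    using mirror_open_interval[OF assms(1)] by (simp add: image_reflect)
  then obtain p q where "reflect f 0 \<le> p" "p < q" "q \<le> reflect f (reflect f 0)" "{p<..<q} \<subseteq> mirror K"
    "\<mu> * ((1 - a) - (1 - b)) \<le> q - p"
    using assms(2-4) by (elim mir.expand_through_f) (auto simp: reflect_def)
  then show thesis
    using that[of "1 - q" "1 - p"] mirror_open_interval[of p q "mirror K"] by (simp add: reflect_def)
qed

text \<open>
  On the castrated part of \<open>f\<close> the image \<open>f ` K\<close> is countable, and likewise for \<open>g\<close>, so the two
  castrated parts have no point of the interval in common. By connectedness the interval lies in one
  of them, and then in the image under the other map up to a set that is both open and countable.
\<close>

lemma interval_in_one_image:
  assumes "{a<..<b} \<subseteq> K" "g 0 \<le> a" "b \<le> f 1"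
  shows "{a<..<b} \<subseteq> f ` K \<or> {a<..<b} \<subseteq> g ` K"
proof -
  define J where "J = {a<..<b}"
  define Rf Rg where "Rf = f ` (\<Union>j. (g ^^ j) ` Hg)" and "Rg = g ` (\<Union>j. (f ^^ j) ` Hf)"
  define Kf Kg where "Kf = f ` K" and "Kg = g ` K"
  have thin: "countable (Kf \<inter> Rf)" "countable (Kg \<inter> Rg)"
    using countable_f_castrated countable_g_castrated by (simp_all add: Kf_def Kg_def Rf_def Rg_def)
  have "open J" "connected J" by (simp_all add: J_def)
  have closed: "closed (Kf)" "closed (Kg)"
    using K_closed K_01 cont_f cont_g unfolding Kf_def Kg_def
    by (auto intro!: compact_imp_closed compact_continuous_image intro: continuous_on_subset
        simp: compact_eq_bounded_closed bounded_subset[OF bounded_closed_interval])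
  have cover: "J \<subseteq> interior Rf \<union> interior Rg"
    using assms(2,3) unfolding J_def Rf_def Rg_def by (intro order_trans[OF _ castration]) auto
  have R: "interior Rf \<subseteq> Rf" "interior Rg \<subseteq> Rg" by (rule interior_subset)+
  have J: "J \<subseteq> Kf \<union> Kg" using assms(1) K_eq by (simp add: J_def Kf_def Kg_def)
  have "J \<inter> interior Rf \<inter> interior Rg \<subseteq> (Kf \<inter> Rf) \<union> (Kg \<inter> Rg)"
    using R J by blast
  then have "interior Rf \<inter> interior Rg \<inter> J = {}"
    using open_subset_countable_eq_empty[of "J \<inter> interior Rf \<inter> interior Rg"]
      countable_Un[OF thin] \<open>open J\<close> by (simp add: open_Int Int_ac)
  then consider "interior Rf \<inter> J = {}" | "interior Rg \<inter> J = {}"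
    using connectedD[of J "interior Rf" "interior Rg"] cover \<open>connected J\<close> by auto
  then show ?thesis
  proof cases
    case 1
    have "J - Kf \<subseteq> Kg \<inter> Rg"
      using 1 cover J R(2) by blast
    moreover have "open (J - Kf)" using closed \<open>open J\<close> by (simp add: open_Diff)
    ultimately have "J - Kf = {}" using open_subset_countable_eq_empty thin(2) by blast
    then show ?thesis unfolding J_def Kf_def Kg_def by blast
  next
    case 2
    have "J - Kg \<subseteq> Kf \<inter> Rf"
      using 2 cover J R(1) by blast
    moreover have "open (J - Kg)" using closed \<open>open J\<close> by (simp add: open_Diff)
    ultimately have "J - Kg = {}" using open_subset_countable_eq_empty thin(1) by blast
    then show ?thesis unfolding J_def Kf_def Kg_def by blast
  qed
qed

text \<open>
  The intervals on which the induced maps act: those of \<open>K\<close> inside one of the two fundamental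
  domains.
\<close>

definition core_interval :: "real \<Rightarrow> real \<Rightarrow> bool" where
  "core_interval a b \<longleftrightarrow> a < b \<and> {a<..<b} \<subseteq> K \<and>
     (f (f 1) \<le> a \<and> b \<le> f 1 \<or> g 0 \<le> a \<and> b \<le> g (g 0))"

lemma open_interval_avoids:
  assumes "{a<..<b} \<subseteq> K" "x \<notin> interior K" shows "x \<le> a \<or> b \<le> x"
  using assms interior_maximal[of "{a<..<b}" K] by (meson greaterThanLessThan_iff linorder_not_le open_greaterThanLessThan subsetD)

lemma core_interval_grows:
  assumes "core_interval a b"
  obtains p q where "core_interval p q" "\<mu> * (b - a) \<le> q - p"
proof -
  have ab: "a < b" "{a<..<b} \<subseteq> K"
    and pos: "f (f 1) \<le> a \<and> b \<le> f 1 \<or> g 0 \<le> a \<and> b \<le> g (g 0)"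
    using assms by (auto simp: core_interval_def)
  have g0: "g 0 \<le> a \<or> b \<le> g 0" and f1: "f 1 \<le> a \<or> b \<le> f 1"
    using open_interval_avoids[OF ab(2)] g_0_notin_interior f_1_notin_interior by auto
  have low: "{a<..<b} \<subseteq> f ` K" if "b \<le> g 0"
  proof
    fix y assume y: "y \<in> {a<..<b}"
    then have "y \<notin> g ` K" using that g_mem K_01 by force
    then show "y \<in> f ` K" using y ab(2) K_eq by blast
  qed
  have high: "{a<..<b} \<subseteq> g ` K" if "f 1 \<le> a"
  proof
    fix y assume y: "y \<in> {a<..<b}"
    then have "y \<notin> f ` K" using that f_mem K_01 by force
    then show "y \<in> g ` K" using y ab(2) K_eq by blast
  qed
  have "f (f 1) \<le> a \<and> b \<le> f 1 \<and> {a<..<b} \<subseteq> f ` K \<or> g 0 \<le> a \<and> b \<le> g (g 0) \<and> {a<..<b} \<subseteq> g ` K"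
    using g0 f1 low high pos interval_in_one_image[OF ab(2)] ab(1) overlap ff_1 gg_0
    by linarith
  then show thesis
  proof (elim disjE conjE)
    assume "f (f 1) \<le> a" "b \<le> f 1" "{a<..<b} \<subseteq> f ` K"
    then show thesis using ab(1) that by (elim expand_through_f) (auto simp: core_interval_def)
  next
    assume "g 0 \<le> a" "b \<le> g (g 0)" "{a<..<b} \<subseteq> g ` K"
    then show thesis using ab(1) that by (elim expand_through_g) (auto simp: core_interval_def)
  qed
qed

lemma no_core_interval: "\<not> core_interval a b"
proof
  assume ab: "core_interval a b"
  have "\<exists>p q. core_interval p q \<and> \<mu> ^ n * (b - a) \<le> q - p" for n
  proof (induction n)
    case (Suc n)
    then obtain p q where pq: "core_interval p q" "\<mu> ^ n * (b - a) \<le> q - p" by blast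
    obtain p' q' where "core_interval p' q'" "\<mu> * (q - p) \<le> q' - p'"
      using core_interval_grows[OF pq(1)] .
    moreover have "\<mu> * (\<mu> ^ n * (b - a)) \<le> \<mu> * (q - p)" using pq(2) mu by (intro mult_left_mono) auto
    ultimately show ?case by (auto simp: mult.assoc intro: order_trans)
  qed (use ab in auto)
  moreover have "q - p \<le> 1" if "core_interval p q" for p q
    using that f_mem'[of "f 1"] f_mem'[of 1] g_mem'[of 0] g_mem'[of "g 0"] by (auto simp: core_interval_def)
  ultimately have bound: "\<mu> ^ n * (b - a) \<le> 1" for n by (meson order_trans)
  have "b - a > 0" using ab by (simp add: core_interval_def)
  obtain n where "1 / (b - a) < \<mu> ^ n" using real_arch_pow[OF mu] by blast
  then show False using bound[of n] \<open>b - a > 0\<close> by (simp add: field_simps)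
qed

theorem interior_K: "interior K = {}"
proof (rule ccontr)
  assume "interior K \<noteq> {}"
  then obtain x e where e: "e > 0" "ball x e \<subseteq> K" by (metis ex_in_conv mem_interior)
  then have ab: "x - e < x + e" "{x - e<..<x + e} \<subseteq> K" by (auto simp: ball_eq_greaterThanLessThan)
  then have "closure {x - e<..<x + e} \<subseteq> {0..1}" using K_01 by (intro closure_minimal) auto
  then have b: "0 \<le> x - e" "x + e \<le> 1" using e(1) by auto
  have "g 0 \<le> x - e \<or> x + e \<le> g 0"
    using open_interval_avoids[OF ab(2)] g_0_notin_interior by blast
  then show False
  proof
    assume "g 0 \<le> x - e"
    with pull_back_by_funpow_g[OF ab(2) _ ab(1)] b show False
      using no_core_interval unfolding core_interval_def by metis
  next
    assume "x + e \<le> g 0"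
    with pull_back_by_funpow_f[OF ab(2) b(1) ab(1)] overlap show False
      using no_core_interval unfolding core_interval_def by (metis less_imp_le order_trans)
  qed
qed

end

section \<open>The unique minimal set\<close>

lemma gen_semigroup_image_subset:
  assumes "\<phi> \<in> gen_semigroup f g" "f ` X \<subseteq> X" "g ` X \<subseteq> X"
  shows "\<phi> ` X \<subseteq> X"
  using assms(1)
proof induction
  case (gen_comp \<phi> \<psi>)
  then show ?case by (metis image_comp image_mono order_trans)
qed (use assms in auto)

lemma orbit_plus_base: "f x \<in> orbit_plus f g x" "g x \<in> orbit_plus f g x"
  unfolding orbit_plus_def by (blast intro: gen_left gen_right)+

lemma orbit_plus_gen:
  assumes "\<phi> \<in> gen_semigroup f g" "y \<in> orbit_plus f g x"
  shows "\<phi> y \<in> orbit_plus f g x"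
proof -
  obtain \<psi> where "\<psi> \<in> gen_semigroup f g" "y = \<psi> x" using assms(2) by (auto simp: orbit_plus_def)
  then have "\<phi> \<circ> \<psi> \<in> gen_semigroup f g" "\<phi> y = (\<phi> \<circ> \<psi>) x" using assms(1) by (auto intro: gen_comp)
  then show ?thesis unfolding orbit_plus_def by blast
qed

lemma orbit_plus_step:
  "y \<in> orbit_plus f g x \<Longrightarrow> f y \<in> orbit_plus f g x" "y \<in> orbit_plus f g x \<Longrightarrow> g y \<in> orbit_plus f g x"
  by (rule orbit_plus_gen[OF gen_left], assumption) (rule orbit_plus_gen[OF gen_right])

lemma orbit_plus_subset:
  assumes "x \<in> X" "f ` X \<subseteq> X" "g ` X \<subseteq> X" shows "orbit_plus f g x \<subseteq> X"
  unfolding orbit_plus_def using assms(1) gen_semigroup_image_subset[OF _ assms(2,3)] by blast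

lemma image_closure_compact:
  assumes "continuous_on {0..1::real} h" "X \<subseteq> {0..1}"
  shows "closure (h ` X) = (h ` closure X :: real set)"
proof
  have X: "closure X \<subseteq> {0..1}" using assms(2) by (intro closure_minimal) auto
  then have "compact (closure X)"
    by (metis bounded_closed_interval bounded_subset closed_closure compact_eq_bounded_closed)
  then have "closed (h ` closure X)"
    using continuous_on_subset[OF assms(1) X] by (intro compact_imp_closed compact_continuous_image)
  then show "closure (h ` X) \<subseteq> h ` closure X"
    by (intro closure_minimal image_mono closure_subset)
  show "h ` closure X \<subseteq> closure (h ` X)"
    using assms(1) X by (rule continuous_image_closure_subset)
qed

context interval_pair
begin

lemma closure_orbit_subset:
  assumes "x \<in> {0..1}" shows "closure (orbit_plus f g x) \<subseteq> {0..1}"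
  by (intro closure_minimal orbit_plus_subset assms image_subsetI f_mem' g_mem') auto

text \<open>
  Injectivity is what keeps the approximating points \<open>\<phi> (f\<^sup>n (g 0))\<close> distinct from \<open>\<phi> 0\<close> below.
\<close>

lemma gen_semigroup_embedding:
  assumes "\<phi> \<in> gen_semigroup f g"
  shows "\<phi> ` {0..1} \<subseteq> {0..1} \<and> continuous_on {0..1} \<phi> \<and> inj_on \<phi> {0..1}"
  using assms
proof induction
  case gen_left
  show ?case using f_mem' cont_f strict_mono_on_imp_inj_on[OF mono_f] by auto
next
  case gen_right
  show ?case using g_mem' cont_g strict_mono_on_imp_inj_on[OF mono_g] by auto
next
  case (gen_comp \<phi> \<psi>)
  then have "\<phi> ` \<psi> ` {0..1} \<subseteq> {0..1}" "continuous_on {0..1} (\<phi> \<circ> \<psi>)" "inj_on (\<phi> \<circ> \<psi>) {0..1}"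
    by (blast intro: comp_inj_on continuous_on_compose continuous_on_subset inj_on_subset)+
  then show ?case by (simp add: image_comp o_def)
qed

lemma image_closure_orbit:
  assumes "x \<in> {0..1}" "\<phi> \<in> gen_semigroup f g"
  shows "\<phi> ` closure (orbit_plus f g x) \<subseteq> closure (orbit_plus f g x)"
proof (rule image_closure_subset)
  show "continuous_on (closure (orbit_plus f g x)) \<phi>"
    using gen_semigroup_embedding[OF assms(2)] closure_orbit_subset[OF assms(1)] continuous_on_subset by blast
  show "\<phi> ` orbit_plus f g x \<subseteq> closure (orbit_plus f g x)"
    using orbit_plus_gen[OF assms(2)] closure_subset by blast
qed simp

lemma closure_orbit_closure_orbit:
  assumes "x \<in> {0..1}" "y \<in> closure (orbit_plus f g x)"
  shows "closure (orbit_plus f g y) \<subseteq> closure (orbit_plus f g x)"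
  by (intro closure_minimal orbit_plus_subset assms image_closure_orbit gen_left gen_right) simp

lemma zero_in_closure_orbit:
  assumes "x \<in> {0..1}" shows "0 \<in> closure (orbit_plus f g x)"
proof -
  have "(f ^^ Suc n) x \<in> orbit_plus f g x" for n
    by (induction n) (auto intro: orbit_plus_base orbit_plus_step)
  moreover have "(\<lambda>n. (f ^^ Suc n) x) \<longlonglongrightarrow> 0"
    by (rule LIMSEQ_Suc[OF funpow_f_tendsto_0[OF assms]])
  ultimately show ?thesis
    unfolding closure_sequential by (intro exI[of _ "\<lambda>n. (f ^^ Suc n) x"]) blast
qed

definition attractor :: "real set" where
  "attractor = closure (orbit_plus f g 0)"

lemma attractor_subset_closure_orbit:
  "x \<in> {0..1} \<Longrightarrow> attractor \<subseteq> closure (orbit_plus f g x)"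
  unfolding attractor_def by (intro closure_orbit_closure_orbit zero_in_closure_orbit)

lemma zero_in_orbit: "0 \<in> orbit_plus f g 0"
  using orbit_plus_base(1)[of f 0 g] f_0 by simp

lemma attractor_01: "attractor \<subseteq> {0..1}"
  unfolding attractor_def by (rule closure_orbit_subset) simp

lemma minimal_set_iff: "minimal_set f g K \<longleftrightarrow> K = attractor"
proof
  assume K: "minimal_set f g K"
  then obtain x where x: "x \<in> K" "x \<in> {0..1}" unfolding minimal_set_def by blast
  then have "closure (orbit_plus f g x) = K" using K by (simp add: minimal_set_def)
  then have "0 \<in> K" using zero_in_closure_orbit[OF x(2)] by simp
  then show "K = attractor" using K by (simp add: minimal_set_def attractor_def)
next
  assume K: "K = attractor"
  have "closure (orbit_plus f g x) = attractor" if "x \<in> attractor" for x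
  proof
    show "closure (orbit_plus f g x) \<subseteq> attractor"
      using that unfolding attractor_def by (intro closure_orbit_closure_orbit) auto
    show "attractor \<subseteq> closure (orbit_plus f g x)"
      using that attractor_01 by (intro attractor_subset_closure_orbit) auto
  qed
  moreover have "attractor \<noteq> {}" unfolding attractor_def using zero_in_orbit by auto
  ultimately show "minimal_set f g K"
    using attractor_01 by (simp add: K minimal_set_def)
qed

lemma attractor_eq: "attractor = f ` attractor \<union> g ` attractor"
proof -
  let ?O = "orbit_plus f g 0"
  have sub: "\<phi> ` ?O \<subseteq> f ` ?O \<union> g ` ?O" if "\<phi> \<in> gen_semigroup f g" for \<phi>
    using that
  proof induction
    case (gen_comp \<phi> \<psi>)
    have "\<psi> ` ?O \<subseteq> ?O" using orbit_plus_gen[OF gen_comp(2)] by blast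
    then show ?case using gen_comp(3) by (auto simp: image_comp[symmetric])
  qed auto
  have "?O = f ` ?O \<union> g ` ?O"
  proof
    show "?O \<subseteq> f ` ?O \<union> g ` ?O"
    proof
      fix y assume "y \<in> ?O"
      then obtain \<phi> where "\<phi> \<in> gen_semigroup f g" "y = \<phi> 0" by (auto simp: orbit_plus_def)
      then show "y \<in> f ` ?O \<union> g ` ?O" using sub zero_in_orbit by blast
    qed
  qed (auto intro: orbit_plus_step)
  moreover have "?O \<subseteq> {0..1}" using closure_orbit_subset[of 0] closure_subset[of ?O] by auto
  ultimately show ?thesis
    unfolding attractor_def using image_closure_compact[OF cont_f] image_closure_compact[OF cont_g]
    by (metis closure_Un)
qed

text \<open>
  The set of limit points is closed, so it is enough to treat the orbit of \<open>0\<close>.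
\<close>

lemma attractor_limpt:
  assumes "x \<in> attractor" shows "x islimpt attractor"
proof -
  let ?O = "orbit_plus f g 0" and ?s = "\<lambda>n. (f ^^ n) (g 0)"
  have s: "?s n \<in> ?O" "0 < ?s n" "?s n \<le> 1" for n
  proof -
    show "?s n \<in> ?O" by (induction n) (auto intro: orbit_plus_base orbit_plus_step)
    show "?s n \<le> 1" using funpow_f_mem[of "g 0" n] g_mem'[of 0] by auto
    show "0 < ?s n"
    proof (induction n)
      case (Suc n)
      then show ?case using f_less_iff[of 0 "?s n"] funpow_f_mem[of "g 0" n] g_mem'[of 0] f_0 by simp
    qed (use g_0_pos in simp)
  qed
  have "?O \<subseteq> {x. x islimpt attractor}"
  proof
    fix y assume "y \<in> ?O"
    then obtain \<phi> where \<phi>: "\<phi> \<in> gen_semigroup f g" "y = \<phi> 0" by (auto simp: orbit_plus_def)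
    note props = gen_semigroup_embedding[OF \<phi>(1)]
    have "?s \<longlonglongrightarrow> 0" by (rule funpow_f_tendsto_0) (use g_mem'[of 0] in auto)
    then have "(\<lambda>n. \<phi> (?s n)) \<longlonglongrightarrow> \<phi> 0"
      using props s by (intro continuous_on_tendsto_compose[of "{0..1}" \<phi>]) (auto simp: less_imp_le)
    moreover have "\<phi> (?s n) \<in> attractor - {y}" for n
    proof -
      have "\<phi> (?s n) \<in> ?O" using orbit_plus_gen[OF \<phi>(1) s(1)] .
      moreover have "\<phi> (?s n) \<noteq> \<phi> 0"
        using props s(2,3)[of n] inj_on_eq_iff[of \<phi> "{0..1}" "?s n" 0] by auto
      ultimately show ?thesis using closure_subset[of ?O] \<phi>(2) by (auto simp: attractor_def)
    qed
    ultimately show "y \<in> {x. x islimpt attractor}"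
      unfolding islimpt_sequential mem_Collect_eq \<phi>(2) by (intro exI[of _ "\<lambda>n. \<phi> (?s n)"]) blast
  qed
  then have "closure ?O \<subseteq> {x. x islimpt attractor}"
    by (rule closure_minimal) (rule closed_limpts)
  then show ?thesis using assms by (auto simp: attractor_def)
qed

lemma attractor_cantor_like:
  assumes "interior attractor = {}" shows "cantor_like attractor"
proof -
  have "compact attractor"
    using attractor_01 unfolding attractor_def
    by (metis bounded_closed_interval bounded_subset closed_closure compact_eq_bounded_closed)
  moreover have "attractor \<noteq> {}" unfolding attractor_def using zero_in_orbit by auto
  ultimately show ?thesis using assms attractor_limpt by (simp add: cantor_like_def)
qed

end

section \<open>Derivatives and inverse branches\<close>

lemma Diff1_im_continuous: "h \<in> Diff1_im \<Longrightarrow> continuous_on {0..1} h"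
  unfolding Diff1_im_def C1_within_def
  by (auto simp: continuous_on_eq_continuous_within intro: DERIV_continuous)

lemma Diff1_im_strict_mono_left:
  assumes h: "h \<in> Diff1_im" and "h 0 = 0" shows "strict_mono_on {0..1} h"
proof (rule strict_mono_onI)
  fix x y :: real assume xy: "x \<in> {0..1}" "y \<in> {0..1}" "x < y"
  have maps: "h ` {0..1} \<subseteq> {0..1}" and inj: "inj_on h {0..1}" using h by (auto simp: Diff1_im_def)
  have "0 \<le> h x" "0 \<le> h y" using maps xy(1,2) by (auto simp: image_subset_iff)
  moreover have "h y \<noteq> h 0" using inj xy by (auto dest: inj_onD)
  moreover have "h 0 < h x \<and> h x < h y \<or> h y < h x \<and> h x < h 0" if "0 < x"
    using that xy by (intro continuous_inj_imp_mono continuous_on_subset[OF Diff1_im_continuous[OF h]]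
        inj_on_subset[OF inj]) auto
  ultimately show "h x < h y" using assms(2) xy(1) by (cases "x = 0") auto
qed

lemma Diff1_im_strict_mono_right:
  assumes h: "h \<in> Diff1_im" and "h 1 = 1" shows "strict_mono_on {0..1} h"
proof (rule strict_mono_onI)
  fix x y :: real assume xy: "x \<in> {0..1}" "y \<in> {0..1}" "x < y"
  have maps: "h ` {0..1} \<subseteq> {0..1}" and inj: "inj_on h {0..1}" using h by (auto simp: Diff1_im_def)
  have "h x \<le> 1" "h y \<le> 1" using maps xy(1,2) by (auto simp: image_subset_iff)
  moreover have "h x \<noteq> h 1" using inj xy by (auto dest: inj_onD)
  moreover have "h x < h y \<and> h y < h 1 \<or> h 1 < h y \<and> h y < h x" if "y < 1"
    using that xy by (intro continuous_inj_imp_mono continuous_on_subset[OF Diff1_im_continuous[OF h]]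
        inj_on_subset[OF inj]) auto
  ultimately show "h x < h y" using assms(2) xy(2) by (cases "y = 1") auto
qed

text \<open>
  Differentiability of the inverse prevents the derivative from vanishing.
\<close>

lemma Diff1_im_deriv:
  assumes h: "h \<in> Diff1_im" and z: "z \<in> {0<..<1}"
  shows "\<exists>D. D \<noteq> 0 \<and> (h has_real_derivative D) (at z)"
proof -
  have inj: "inj_on h {0..1}" using h by (auto simp: Diff1_im_def)
  have z01: "z \<in> {0..1}" using z by auto
  then obtain D where D: "(h has_real_derivative D) (at z within {0..1})"
    using h unfolding Diff1_im_def C1_within_def by blast
  obtain E where E: "(I_inv h has_real_derivative E) (at (h z) within h ` {0..1})"
    using h z01 unfolding Diff1_im_def C1_within_def by blast
  have "((\<lambda>x. I_inv h (h x)) has_real_derivative E * D) (at z within {0..1})"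
    using DERIV_image_chain[OF E D] by (simp add: o_def)
  then have "((\<lambda>x. x) has_real_derivative E * D) (at z within {0..1})"
    by (rule has_field_derivative_transform_within[where d = 1]) (use z inj in \<open>auto simp: the_inv_into_f_f\<close>)
  then have "((\<lambda>x. x) has_real_derivative E * D) (at z)" using z by (simp add: at_within_Icc_at)
  then have "E * D = 1" using DERIV_unique DERIV_ident by blast
  moreover have "(h has_real_derivative D) (at z)" using D z by (simp add: at_within_Icc_at)
  ultimately show ?thesis by (metis mult_zero_right zero_neq_one)
qed

lemma funpow_deriv:
  assumes k: "k \<in> Diff1_im" "\<And>x. x \<in> {0<..<1} \<Longrightarrow> k x \<in> {0<..<1}" and z: "z \<in> {0<..<1}"
  shows "(k ^^ j) z \<in> {0<..<1} \<and> (\<exists>D. D \<noteq> 0 \<and> ((k ^^ j) has_real_derivative D) (at z))"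
proof (induction j)
  case 0
  show ?case using z by (auto simp: id_def intro!: exI[of _ 1])
next
  case (Suc j)
  then obtain D where D: "D \<noteq> 0" "((k ^^ j) has_real_derivative D) (at z)" by blast
  obtain E where E: "E \<noteq> 0" "(k has_real_derivative E) (at ((k ^^ j) z))"
    using Diff1_im_deriv[OF k(1)] Suc by blast
  have "((k ^^ Suc j) has_real_derivative E * D) (at z)"
    using DERIV_chain[OF E(2) D(2)] by simp
  then show ?case using Suc k(2) D E by (metis comp_apply funpow.simps(2) mult_eq_0_iff)
qed

text \<open>
  The mean value theorem is applied to \<open>\<phi>\<close> and not to \<open>F\<close>, so that nothing has to be known about \<open>F\<close>
  at the end points, where an induced map may jump. At the intermediate point the derivative of \<open>F\<close> is
  the reciprocal of that of \<open>\<phi>\<close>; that it exceeds \<open>\<mu>\<close> also yields the sign.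
\<close>

lemma expansion_of_left_inverse:
  fixes \<phi> F :: "real \<Rightarrow> real"
  assumes "p < q" and cont: "continuous_on {p..q} \<phi>"
    and deriv: "\<And>z. z \<in> {p<..<q} \<Longrightarrow> \<exists>D. D \<noteq> 0 \<and> (\<phi> has_real_derivative D) (at z)"
    and inv: "\<And>z. z \<in> {p<..<q} \<Longrightarrow> F (\<phi> z) = z"
    and big: "\<And>z D. z \<in> {p<..<q} \<Longrightarrow> (F has_real_derivative D) (at (\<phi> z) within S) \<Longrightarrow> \<mu> < D"
    and "1 < \<mu>"
  shows "\<mu> * (\<phi> q - \<phi> p) \<le> q - p"
proof -
  have "\<phi> differentiable (at z)" if "p < z" "z < q" for z
    using deriv[of z] that by (auto simp: real_differentiable_def)
  from MVT[OF assms(1) cont this] obtain l \<xi> where l: "p < \<xi>" "\<xi> < q"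
    "(\<phi> has_real_derivative l) (at \<xi>)" "\<phi> q - \<phi> p = (q - p) * l" by blast
  have "l \<noteq> 0" using deriv[of \<xi>] l DERIV_unique by force
  have "(F has_derivative (*) (inverse l)) (at (\<phi> \<xi>))"
  proof (rule has_derivative_inverse_strong[of "{p<..<q}" \<xi> \<phi> F "(*) l"])
    show "continuous_on {p<..<q} \<phi>" by (rule continuous_on_subset[OF cont]) auto
  qed (use l \<open>l \<noteq> 0\<close> inv in \<open>auto simp: has_field_derivative_def fun_eq_iff\<close>)
  then have "(F has_real_derivative inverse l) (at (\<phi> \<xi>))" by (simp add: has_field_derivative_def)
  then have "\<mu> < inverse l" using big[of \<xi>] l has_field_derivative_at_within by fastforce
  moreover from this have "0 < l" using assms(6) by (smt (verit) inverse_positive_iff_positive)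
  ultimately have "\<mu> * l < 1" using \<open>l \<noteq> 0\<close> mult_strict_right_mono[of \<mu> "inverse l" l] by simp
  then have "\<mu> * l * (q - p) \<le> 1 * (q - p)" using assms(1) by (intro mult_right_mono) auto
  then show ?thesis using l(4) by (simp add: mult_ac)
qed

lemma funpow_I_inv_funpow:
  assumes "inj_on h {0..1}" "h ` {0..1} \<subseteq> {0..1}" "z \<in> {0..1}" "n \<le> j"
  shows "(I_inv h ^^ n) ((h ^^ j) z) = (h ^^ (j - n)) z"
  using assms(4)
proof (induction n)
  case (Suc n)
  have "(h ^^ i) z \<in> {0..1}" for i
    by (induction i) (use assms(2,3) in \<open>auto simp: image_subset_iff\<close>)
  moreover have "j - n = Suc (j - Suc n)" using Suc.prems by simp
  ultimately show ?case using Suc assms(1) by (simp add: the_inv_into_f_f)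
qed simp

text \<open>
  No proper forward iterate of \<open>z\<close> meets \<open>T\<close>, so the backward search from \<open>h\<^sup>j z\<close> stops exactly
  at \<open>z\<close>.
\<close>

lemma unwind_Least:
  assumes "inj_on h {0..1}" "h ` {0..1} \<subseteq> {0..1}" "z \<in> {0..1}" "z \<in> T" "\<And>i. 0 < i \<Longrightarrow> (h ^^ i) z \<notin> T"
  shows "(I_inv h ^^ (LEAST n. (I_inv h ^^ n) ((h ^^ j) z) \<in> T)) ((h ^^ j) z) = z"
proof -
  note inv = funpow_I_inv_funpow[OF assms(1-3), of _ j]
  have "(LEAST n. (I_inv h ^^ n) ((h ^^ j) z) \<in> T) = j"
  proof (rule Least_equality)
    show "(I_inv h ^^ j) ((h ^^ j) z) \<in> T" using inv[of j] assms(4) by simp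
    show "j \<le> n" if "(I_inv h ^^ n) ((h ^^ j) z) \<in> T" for n
    proof (rule ccontr)
      assume "\<not> j \<le> n"
      then show False using that inv[of n] assms(5)[of "j - n"] by simp
    qed
  qed
  then show ?thesis using inv[of j] by simp
qed

text \<open>
  Before the search stops, the backward orbit stays in \<open>B - T\<close>, where the inverse is a true one. If no
  iterate enters \<open>T\<close>, the least number is unspecified, but then every number of steps can be undone,
  so its existence need not be established.
\<close>

lemma rewind_Least:
  assumes "inj_on h {0..1}" "u \<in> B" "\<And>y. y \<in> B - T \<Longrightarrow> y \<in> h ` {0..1} \<and> I_inv h y \<in> B"
  defines "n \<equiv> LEAST n. (I_inv h ^^ n) u \<in> T"
  shows "(h ^^ n) ((I_inv h ^^ n) u) = u"
proof -
  have "(I_inv h ^^ m) u \<in> B \<and> (h ^^ m) ((I_inv h ^^ m) u) = u" if "m \<le> n" for m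
    using that
  proof (induction m)
    case (Suc m)
    let ?y = "(I_inv h ^^ m) u"
    have "?y \<notin> T" using Suc.prems not_less_Least[of m "\<lambda>n. (I_inv h ^^ n) u \<in> T"] by (simp add: n_def)
    then have "?y \<in> h ` {0..1}" "I_inv h ?y \<in> B" using assms(3) Suc by auto
    moreover from this have "(h ^^ Suc m) (I_inv h ?y) = u"
      using Suc f_the_inv_into_f[OF assms(1)] by (simp add: funpow_swap1[of h])
    ultimately show ?case by simp
  qed (use assms(2) in simp)
  then show ?thesis by blast
qed

text \<open>
  Taking \<open>h\<close>, \<open>k\<close>, \<open>T\<close>, \<open>S\<close> to be \<open>f\<close>, \<open>g\<close>, \<open>G\<^sub>1\<close> and the domain of \<open>\<F>\<close> makes \<open>E\<close> the map \<open>\<F>\<close>, and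
  exchanging the two maps gives \<open>\<G>\<close>.
\<close>

lemma induced_expansion:
  assumes h: "h \<in> Diff1_im" and k: "k \<in> Diff1_im" "\<And>x. x \<in> {0<..<1} \<Longrightarrow> k x \<in> {0<..<1}"
    and E: "\<And>x. E x = (I_inv k ^^ (LEAST n. (I_inv k ^^ n) (I_inv h x) \<in> T)) (I_inv h x)"
    and big: "\<And>y D. y \<in> S - H \<Longrightarrow> (E has_real_derivative D) (at y within S) \<Longrightarrow> \<mu> < D" and "1 < \<mu>"
    and pq: "0 \<le> p" "p < q" "q \<le> 1"
    and z: "\<And>z. z \<in> {p<..<q} \<Longrightarrow> z \<in> T \<and> (\<forall>i>0. (k ^^ i) z \<notin> T) \<and> h ((k ^^ j) z) \<in> S - H"
  shows "\<mu> * (h ((k ^^ j) q) - h ((k ^^ j) p)) \<le> q - p"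
proof (rule expansion_of_left_inverse[where F = E and S = S])
  have maps: "h ` {0..1} \<subseteq> {0..1}" "k ` {0..1} \<subseteq> {0..1}" and inj: "inj_on h {0..1}" "inj_on k {0..1}"
    using h k by (auto simp: Diff1_im_def)
  have mem: "(k ^^ i) x \<in> {0..1}" if "x \<in> {0..1}" for i x
    by (induction i) (use that maps in \<open>auto simp: image_subset_iff\<close>)
  have "continuous_on {0..1} (k ^^ j)"
  proof (induction j)
    case (Suc j)
    show ?case unfolding funpow.simps
      by (rule continuous_on_compose[OF Suc continuous_on_subset[OF Diff1_im_continuous[OF k(1)]]]) (use mem in auto)
  qed (simp add: id_def continuous_on_id)
  then have "continuous_on {0..1} (\<lambda>x. h ((k ^^ j) x))"
    by (rule continuous_on_compose2[OF Diff1_im_continuous[OF h]]) (use mem in auto)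
  then show "continuous_on {p..q} (\<lambda>x. h ((k ^^ j) x))"
    by (rule continuous_on_subset) (use pq in auto)
  fix x assume x: "x \<in> {p<..<q}"
  then have x01: "x \<in> {0<..<1}" "x \<in> {0..1}" using pq by auto
  obtain D where D: "D \<noteq> 0" "((k ^^ j) has_real_derivative D) (at x)"
    and kx: "(k ^^ j) x \<in> {0<..<1}"
    using funpow_deriv[OF k x01(1)] by blast
  obtain C where C: "C \<noteq> 0" "(h has_real_derivative C) (at ((k ^^ j) x))"
    using Diff1_im_deriv[OF h kx] by blast
  show "\<exists>D. D \<noteq> 0 \<and> ((\<lambda>x. h ((k ^^ j) x)) has_real_derivative D) (at x)"
    using DERIV_chain2[OF C(2) D(2)] C(1) D(1) by (intro exI[of _ "C * D"]) simp
  have "I_inv h (h ((k ^^ j) x)) = (k ^^ j) x" using inj(1) mem x01 by (simp add: the_inv_into_f_f)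
  then show "E (h ((k ^^ j) x)) = x"
    using unwind_Least[OF inj(2) maps(2) x01(2), of T j] z[OF x] by (simp add: E)
  show "\<mu> < D" if "(E has_real_derivative D) (at (h ((k ^^ j) x)) within S)" for D
    using big z[OF x] that by blast
qed (use assms in auto)

lemma induced_preimage:
  assumes "inj_on h {0..1}" "inj_on k {0..1}"
    and "x \<in> h ` {0..1}" "I_inv h x \<in> B" "\<And>y. y \<in> B - T \<Longrightarrow> y \<in> k ` {0..1} \<and> I_inv k y \<in> B"
    and "(I_inv k ^^ (LEAST n. (I_inv k ^^ n) (I_inv h x) \<in> T)) (I_inv h x) \<in> H"
  shows "x \<in> h ` (\<Union>j. (k ^^ j) ` H)"
proof -
  define n where "n = (LEAST n. (I_inv k ^^ n) (I_inv h x) \<in> T)"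
  have "(k ^^ n) ((I_inv k ^^ n) (I_inv h x)) = I_inv h x"
    unfolding n_def by (rule rewind_Least[OF assms(2,4,5)])
  moreover have "(I_inv k ^^ n) (I_inv h x) \<in> H" using assms(6) by (simp add: n_def)
  ultimately have "I_inv h x \<in> (k ^^ n) ` H" by (metis imageI)
  then have "I_inv h x \<in> (\<Union>j. (k ^^ j) ` H)" by blast
  moreover have "h (I_inv h x) = x" using f_the_inv_into_f[OF assms(1,3)] .
  ultimately show ?thesis by (intro image_eqI[of _ h "I_inv h x"]) simp_all
qed

section \<open>From the induced maps to the holed pair\<close>

lemma class_A_interval_pair:
  assumes "(f, g) \<in> class_A" shows "interval_pair f g"
proof
  from assms have A: "f \<in> Diff1_im" "g \<in> Diff1_im" "f 0 = 0" "g 1 = 1" "0 < g 0" "f 1 < 1"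
    "\<And>x. 0 < x \<Longrightarrow> x < 1 \<Longrightarrow> f x < x \<and> x < g x"
    by (auto simp: class_A_def)
  show "strict_mono_on {0..1} f" "strict_mono_on {0..1} g"
    using A by (auto intro: Diff1_im_strict_mono_left Diff1_im_strict_mono_right)
  show "continuous_on {0..1} f" "continuous_on {0..1} g"
    using A by (auto intro: Diff1_im_continuous)
  show "f x < x" if "0 < x" "x \<le> 1" for x using A that by (cases "x = 1") auto
  show "x < g x" if "0 \<le> x" "x < 1" for x using A that by (cases "x = 0") auto
qed (use assms in \<open>auto simp: class_A_def\<close>)

text \<open>
  The complement \<open>X\<close> of the holes is forward invariant: each hole is the full image of the other one
  under the only map that reaches it. As \<open>0 \<in> X\<close>, the closure of the orbit of \<open>0\<close> stays off the
  interiors of the holes.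
\<close>

theorem class_C_holed_pair:
  assumes "(f, g) \<in> class_C"
  shows "\<exists>Hf Hg \<mu>. holed_pair f g Hf Hg (interval_pair.attractor f g) \<mu>"
proof -
  from assms obtain Hf Hg where A: "(f, g) \<in> class_A" and So: "prop_So f g"
    and Ho: "prop_Ho f g Hf Hg" and Ee: "prop_Ee f g Hf Hg" and Ca: "prop_Ca f g Hf Hg"
    by (auto simp: class_C_def)
  interpret interval_pair f g by (rule class_A_interval_pair[OF A])
  have D: "f \<in> Diff1_im" "g \<in> Diff1_im" and overlap: "g 0 < f 1" using A by (auto simp: class_A_def)
  then have inj: "inj_on f {0..1}" "inj_on g {0..1}" by (auto simp: Diff1_im_def)
  have F1: "fund_F f 1 = {f (f 1)..f 1}" and G1: "fund_G g 1 = {g 0..g (g 0)}"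
    by (simp_all add: fund_F_def fund_G_def)
  note FG = F1[unfolded One_nat_def] G1[unfolded One_nat_def]
  have f1: "f 1 \<in> {0<..<1}" and g0: "g 0 \<in> {0<..<1}"
    using f_1_less g_0_pos g_0_less overlap by auto
  have ff1: "0 < f (f 1)" "f (f 1) < f 1" and gg0: "g (g 0) < 1" "g 0 < g (g 0)"
    using f_less_iff[of 0 "f 1"] f_below[of "f 1"] f_0 g_less_iff[of "g 0" 1] g_above[of "g 0"] g_1 f1 g0 by auto
  define U where "U = interior (fund_F f 1 \<union> fund_G g 1)"
  have U: "open U" "{g 0..f 1} \<subseteq> U" "U \<subseteq> {f (f 1)..f 1} \<union> {g 0..g (g 0)}"
    using So interior_subset unfolding prop_So_def overlap_W_def U_def F1 G1 by auto
  \<comment> \<open>A neighbourhood of \<open>g 0\<close> in \<open>F\<^sub>1 \<union> G\<^sub>1\<close> has points left of \<open>g 0\<close>, and these are in \<open>F\<^sub>1\<close>.\<close>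
  obtain e where e: "e > 0" "ball (g 0) e \<subseteq> U" 
    using U(1,2) overlap by (meson atLeastAtMost_iff less_imp_le openE order_refl subsetD)
  have "g 0 - e / 2 \<in> U" using e by (auto simp: dist_real_def)
  then have so_f: "f (f 1) < g 0" using U(3) e(1) by auto
  obtain e' where e': "e' > 0" "ball (f 1) e' \<subseteq> U" 
    using U(1,2) overlap by (meson atLeastAtMost_iff less_imp_le openE order_refl subsetD)
  have "f 1 + e' / 2 \<in> U" using e' by (auto simp: dist_real_def)
  then have so_g: "f 1 < g (g 0)" using U(3) e'(1) by auto

  have Hf_sub: "Hf \<subseteq> {f (f 1)..<g 0}" and Hg_sub: "Hg \<subseteq> {f 1<..g (g 0)}"
    using Ho interior_subset[of "fund_F f 1 - overlap_W f g"] interior_subset[of "fund_G g 1 - overlap_W f g"]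
    unfolding prop_Ho_def F1 G1 overlap_W_def by force+
  have swap: "g ` Hf = Hg" "f ` Hg = Hf" using Ho by (auto simp: prop_Ho_def)
  define X where "X = {0..1} - (Hf \<union> Hg)"
  have Hf01: "Hf \<subseteq> {0..1}" and Hg01: "Hg \<subseteq> {0..1}" using Hf_sub Hg_sub ff1 g0 gg0 f1 by auto
  have "f x \<in> X" if x: "x \<in> X" for x
  proof -
    have "f x \<in> {0..1}" "f x \<notin> Hg" using x f_mem'[of x] f_mem[of x] Hg_sub by (auto simp: X_def)
    moreover have "f x \<notin> Hf"
    proof
      assume "f x \<in> Hf"
      then obtain h where h: "h \<in> Hg" "f x = f h" using swap by blast
      then have "x = h" using inj_onD[OF inj(1), of x h] x Hg01 unfolding X_def by blast
      then show False using h x by (simp add: X_def)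
    qed
    ultimately show ?thesis by (simp add: X_def)
  qed
  moreover have "g x \<in> X" if x: "x \<in> X" for x
  proof -
    have "g x \<in> {0..1}" "g x \<notin> Hf" using x g_mem'[of x] g_mem[of x] Hf_sub by (auto simp: X_def)
    moreover have "g x \<notin> Hg"
    proof
      assume "g x \<in> Hg"
      then obtain h where h: "h \<in> Hf" "g x = g h" using swap by blast
      then have "x = h" using inj_onD[OF inj(2), of x h] x Hf01 unfolding X_def by blast
      then show False using h x by (simp add: X_def)
    qed
    ultimately show ?thesis by (simp add: X_def)
  qed
  moreover have "0 \<in> X" using Hf_sub Hg_sub ff1 f1 by (auto simp: X_def)
  ultimately have "orbit_plus f g 0 \<subseteq> X" by (intro orbit_plus_subset) auto
  then have K_X: "attractor \<subseteq> closure X" unfolding attractor_def by (rule closure_mono)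
  have holes: "countable (attractor \<inter> H) \<and> interior attractor \<inter> H = {}"
    if H: "nondeg_closed_interval H" "H \<inter> X = {}" for H
  proof -
    obtain a b where ab: "a < b" "H = {a..b}" using H(1) by (auto simp: nondeg_closed_interval_def)
    have "{a<..<b} \<inter> X = {}" using H(2) ab by auto
    then have "{a<..<b} \<inter> closure X = {}" using open_Int_closure_eq_empty[of "{a<..<b}" X] by simp
    then have K: "attractor \<inter> {a<..<b} = {}" using K_X by blast
    then have "attractor \<inter> H \<subseteq> {a, b}" using ab by force
    then have "countable (attractor \<inter> H)" by (rule countable_subset) simp
    moreover have "interior attractor \<inter> {a<..<b} = {}" using K interior_subset[of attractor] by blast
    then have "interior attractor \<inter> closure {a<..<b} = {}" using open_Int_closure_eq_empty[of "interior attractor"] by simp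
    then have "interior attractor \<inter> H = {}" using ab by simp
    ultimately show ?thesis by simp
  qed
  have hole_f: "countable (attractor \<inter> Hf) \<and> interior attractor \<inter> Hf = {}"
    and hole_g: "countable (attractor \<inter> Hg) \<and> interior attractor \<inter> Hg = {}"
    using Ho by (intro holes; auto simp: prop_Ho_def X_def)+

  have f_img: "y \<in> f ` {0..1}" if "0 \<le> y" "y \<le> f 1" for y
    using IVT'[of f 0 y 1] that f_0 cont_f by auto
  have g_img: "y \<in> g ` {0..1}" if "g 0 \<le> y" "y \<le> 1" for y
    using IVT'[of g 0 y 1] that g_1 cont_g by auto
  have f_inv: "I_inv f (f x) = x" if "x \<in> {0..1}" for x using the_inv_into_f_f[OF inj(1) that] .
  have g_inv: "I_inv g (g x) = x" if "x \<in> {0..1}" for x using the_inv_into_f_f[OF inj(2) that] .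

  have Rf: "{x \<in> dom_F f. induced_F f g x \<in> Hg} \<subseteq> f ` (\<Union>j. (g ^^ j) ` Hg)"
  proof
    fix x assume "x \<in> {x \<in> dom_F f. induced_F f g x \<in> Hg}"
    then have x: "f (f 1) \<le> x" "x \<le> f 1" and ind: "induced_F f g x \<in> Hg" by (auto simp: dom_F_def FG)
    then obtain u where u: "u \<in> {0..1}" "x = f u" using f_img[of x] ff1 by auto
    have "f 1 \<le> u" using f_le_iff[of "f 1" u] u x f1 by auto
    show "x \<in> f ` (\<Union>j. (g ^^ j) ` Hg)"
    proof (rule induced_preimage[OF inj, where B = "{g 0..1}" and T = "fund_G g 1"])
      fix y assume y: "y \<in> {g 0..1} - fund_G g 1"
      then obtain v where v: "v \<in> {0..1}" "y = g v" using g_img[of y] by auto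
      then have "g 0 \<le> v" using y g_less_iff[of v "g 0"] g0 by (force simp: FG)
      then show "y \<in> g ` {0..1} \<and> I_inv g y \<in> {g 0..1}" using v g_inv by auto
    qed (use u f_inv \<open>f 1 \<le> u\<close> overlap ind in \<open>auto simp: induced_F_def\<close>)
  qed
  have Rg: "{x \<in> dom_G g. induced_G f g x \<in> Hf} \<subseteq> g ` (\<Union>j. (f ^^ j) ` Hf)"
  proof
    fix x assume "x \<in> {x \<in> dom_G g. induced_G f g x \<in> Hf}"
    then have x: "g 0 \<le> x" "x \<le> g (g 0)" and ind: "induced_G f g x \<in> Hf" by (auto simp: dom_G_def FG)
    then obtain u where u: "u \<in> {0..1}" "x = g u" using g_img[of x] gg0 by auto
    have "u \<le> g 0" using g_le_iff[of u "g 0"] u x g0 by auto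
    show "x \<in> g ` (\<Union>j. (f ^^ j) ` Hf)"
    proof (rule induced_preimage[OF inj(2,1), where B = "{0..f 1}" and T = "fund_F f 1"])
      fix y assume y: "y \<in> {0..f 1} - fund_F f 1"
      then obtain v where v: "v \<in> {0..1}" "y = f v" using f_img[of y] by auto
      then have "v \<le> f 1" using y f_less_iff[of "f 1" v] f1 by (force simp: FG)
      then show "y \<in> f ` {0..1} \<and> I_inv f y \<in> {0..f 1}" using v f_inv by auto
    qed (use u g_inv \<open>u \<le> g 0\<close> overlap ind in \<open>auto simp: induced_G_def\<close>)
  qed

  obtain \<mu> where mu: "1 < \<mu>"
    and EeF: "\<And>y D. y \<in> dom_F f - Hf \<Longrightarrow> (induced_F f g has_real_derivative D) (at y within dom_F f) \<Longrightarrow> \<mu> < D"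
    and EeG: "\<And>y D. y \<in> dom_G g - Hg \<Longrightarrow> (induced_G f g has_real_derivative D) (at y within dom_G g) \<Longrightarrow> \<mu> < D"
    using Ee unfolding prop_Ee_def by blast
  have f_int: "f x \<in> {0<..<1}" if "x \<in> {0<..<1}" for x
    using that f_less_iff[of 0 x] f_0 f_below[of x] by auto
  have g_int: "g x \<in> {0<..<1}" if "x \<in> {0<..<1}" for x
    using that g_less_iff[of x 1] g_1 g_above[of x] by auto
  have g_far: "(g ^^ i) z \<notin> fund_G g 1" if "g 0 < z" "z \<le> 1" "0 < i" for i z
  proof -
    have "g 0 < (g ^^ m) z" for m
    proof (induction m)
      case (Suc m)
      then show ?case using g_less_iff[of 0 "(g ^^ m) z"] funpow_g_mem[of z m] that g0 by auto
    qed (use that in simp)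
    then have "g (g 0) < (g ^^ Suc m) z" for m
      using g_less_iff[of "g 0" "(g ^^ m) z"] funpow_g_mem[of z m] that g0 by auto
    from this[of "i - 1"] show ?thesis using that(3) by (auto simp: FG simp del: funpow.simps)
  qed
  have f_far: "(f ^^ i) z \<notin> fund_F f 1" if "0 \<le> z" "z < f 1" "0 < i" for i z
  proof -
    have "(f ^^ m) z < f 1" for m
    proof (induction m)
      case (Suc m)
      then show ?case using f_less_iff[of "(f ^^ m) z" 1] funpow_f_mem[of z m] that f1 by auto
    qed (use that in simp)
    then have "(f ^^ Suc m) z < f (f 1)" for m
      using f_less_iff[of "(f ^^ m) z" "f 1"] funpow_f_mem[of z m] that f1 by auto
    from this[of "i - 1"] show ?thesis using that(3) by (auto simp: FG simp del: funpow.simps)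
  qed

  have "holed_pair f g Hf Hg attractor \<mu>"
  proof unfold_locales
    show "Hf \<subseteq> {0..<g 0}" "Hg \<subseteq> {f 1<..1}" using Hf_sub Hg_sub ff1 gg0 by auto
    show "closed attractor" by (simp add: attractor_def)
    show "{g 0..f 1} \<subseteq> interior (f ` (\<Union>j. (g ^^ j) ` Hg)) \<union> interior (g ` (\<Union>j. (f ^^ j) ` Hf))"
      using Ca interior_mono[OF Rf] interior_mono[OF Rg] unfolding prop_Ca_def overlap_W_def by blast
    show "\<mu> * (f ((g ^^ j) q) - f ((g ^^ j) p)) \<le> q - p"
      if low: "f (f 1) \<le> f ((g ^^ j) p)" and pq: "g 0 \<le> p" "p < q" "q \<le> g (g 0)"
        and off: "{f ((g ^^ j) p)<..<f ((g ^^ j) q)} \<inter> Hf = {}" for j p q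
    proof (rule induced_expansion[OF D(1,2) g_int, where E = "induced_F f g" and T = "fund_G g 1" and S = "dom_F f" and H = Hf])
      show "z \<in> fund_G g 1 \<and> (\<forall>i>0. (g ^^ i) z \<notin> fund_G g 1) \<and> f ((g ^^ j) z) \<in> dom_F f - Hf"
        if z: "z \<in> {p<..<q}" for z
      proof -
        have mem: "p \<in> {0..1}" "z \<in> {0..1}" "q \<in> {0..1}" using z pq g0 gg0 by auto
        have "f ((g ^^ j) p) < f ((g ^^ j) z)" "f ((g ^^ j) z) < f ((g ^^ j) q)"
          using z mem by (simp_all add: f_less_iff funpow_g_less_iff funpow_g_mem del: atLeastAtMost_iff)
        moreover have "f ((g ^^ j) q) \<le> f 1" using f_mem[OF funpow_g_mem[OF mem(3)]] by simp
        ultimately show ?thesis using off low z pq g_far[of z] mem by (auto simp: dom_F_def FG)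
      qed
    qed (use EeF mu pq g0 gg0 in \<open>auto simp: induced_F_def\<close>)
    show "\<mu> * (g ((f ^^ j) q) - g ((f ^^ j) p)) \<le> q - p"
      if high: "g ((f ^^ j) q) \<le> g (g 0)" and pq: "f (f 1) \<le> p" "p < q" "q \<le> f 1"
        and off: "{g ((f ^^ j) p)<..<g ((f ^^ j) q)} \<inter> Hg = {}" for j p q
    proof (rule induced_expansion[OF D(2,1) f_int, where E = "induced_G f g" and T = "fund_F f 1" and S = "dom_G g" and H = Hg])
      show "z \<in> fund_F f 1 \<and> (\<forall>i>0. (f ^^ i) z \<notin> fund_F f 1) \<and> g ((f ^^ j) z) \<in> dom_G g - Hg"
        if z: "z \<in> {p<..<q}" for z
      proof -
        have mem: "p \<in> {0..1}" "z \<in> {0..1}" "q \<in> {0..1}" using z pq f1 ff1 by auto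
        have "g ((f ^^ j) p) < g ((f ^^ j) z)" "g ((f ^^ j) z) < g ((f ^^ j) q)"
          using z mem by (simp_all add: g_less_iff funpow_f_less_iff funpow_f_mem del: atLeastAtMost_iff)
        moreover have "g 0 \<le> g ((f ^^ j) p)" using g_mem[OF funpow_f_mem[OF mem(1)]] by simp
        ultimately show ?thesis using off high z pq f_far[of z] mem by (auto simp: dom_G_def FG)
      qed
    qed (use EeG mu pq f1 ff1 in \<open>auto simp: induced_G_def\<close>)
  qed (use overlap so_f so_g attractor_01 attractor_eq hole_f hole_g mu in auto)
  then show ?thesis by blast
qed

theorem mainTheorem1:
  fixes f g :: "real \<Rightarrow> real"
  assumes "(f, g) \<in> class_C"
  shows "(\<exists>!K. minimal_set f g K) \<and>
         (\<forall>K. minimal_set f g K \<longrightarrow> K homeomorphic cantor_set)"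
proof -
  obtain Hf Hg \<mu> where "holed_pair f g Hf Hg (interval_pair.attractor f g) \<mu>"
    using class_C_holed_pair[OF assms] by blast
  then interpret holed_pair f g Hf Hg "interval_pair.attractor f g" \<mu> .
  have "attractor homeomorphic cantor_set"
    by (intro cantor_like_homeomorphic attractor_cantor_like cantor_like_cantor_set interior_K)
  then show ?thesis by (auto simp: minimal_set_iff)
qed

end
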